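(* Let $G$ be a connected finite simple graph, let $k \geq 2$ be an integer, and let $S \subseteq V(G)$. Then either $G$ has a $k$-ended tree $T$ covering $S$ (i.e. with $S \subseteq V(T)$), or there exists a $k$-ended tree $T$ in $G$ such that $$\alpha_G(S - V(T)) \leq \alpha_G(S) - \kappa_G(S) - k + 1.$$
   Context: All graphs are finite and simple. For a graph $G$ and $S \subseteq V(G)$, $\alpha_G(S)$ denotes the maximum cardinality of a subset of $S$ that is independent in $G$ (no two of its vertices are adjacent in $G$); $S - V(T)$ is the set difference. For two distinct vertices $x, y$ of $G$, the local connectivity $\kappa_G(x,y)$ is the maximum number of pairwise internally disjoint paths connecting $x$ and $y$ in $G$ (if $x,y$ are adjacent, the edge $xy$ counts as one such path). Define $\kappa_G(S) := \min\{\kappa_G(x,y) : x,y \in S,\ x \neq y\}$ if $|S| \geq 2$, and $\kappa_G(S) := +\infty$ if $|S| \leq 1$. The displayed inequality is between (extended) integers, so its right-hand side may be negative or $-\infty$, in which case the inequality fails. A leaf of a tree $T$ is a vertex of degree one in $T$. A $k$-ended tree is a tree having at most $k$ leaves. A tree in $G$ is a subgraph of $G$ that is a tree, not necessarily spanning. *)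

theory Defs
  imports "Graph_Theory.Graph_Theory" "HOL-Library.Extended_Real"
begin

text \<open>
  A finite simple graph is a digraph satisfying the locale \<open>graph\<close>: finite, loopfree, without
  parallel arcs, and symmetric. Thus every edge \<open>xy\<close> is represented by the two arcs from \<open>x\<close>
  to \<open>y\<close> and from \<open>y\<close> to \<open>x\<close>.
\<close>

definition independent_in :: "('a, 'b) pre_digraph \<Rightarrow> 'a set \<Rightarrow> bool" where
  "independent_in G I \<longleftrightarrow> I \<subseteq> verts G \<and> (\<forall>u \<in> I. \<forall>v \<in> I. \<not> u \<rightarrow>\<^bsub>G\<^esub> v)"

definition alpha :: "('a, 'b) pre_digraph \<Rightarrow> 'a set \<Rightarrow> nat" where
  "alpha G S = Max {card I | I. I \<subseteq> S \<and> independent_in G I}"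

text \<open>
  A path is given by its list of vertices, so in a simple graph an edge \<open>xy\<close> contributes exactly
  one path \<open>[x, y]\<close> from \<open>x\<close> to \<open>y\<close>. Two paths from \<open>x\<close> to \<open>y\<close> are internally disjoint iff they
  have only \<open>x\<close> and \<open>y\<close> in common.
\<close>

definition paths_between :: "('a, 'b) pre_digraph \<Rightarrow> 'a \<Rightarrow> 'a \<Rightarrow> 'a list set" where
  "paths_between G x y = {p. vpath p G \<and> hd p = x \<and> last p = y}"

definition local_connectivity :: "('a, 'b) pre_digraph \<Rightarrow> 'a \<Rightarrow> 'a \<Rightarrow> nat" where
  "local_connectivity G x y =
     Max {card P | P. P \<subseteq> paths_between G x y \<and> pairwise (\<lambda>p q. set p \<inter> set q = {x, y}) P}"

definition set_connectivity :: "('a, 'b) pre_digraph \<Rightarrow> 'a set \<Rightarrow> enat" where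
  "set_connectivity G S =
     (if card S \<le> 1 then \<infinity>
      else enat (Min {local_connectivity G x y | x y. x \<in> S \<and> y \<in> S \<and> x \<noteq> y}))"

text \<open>
  The constants \<open>forest\<close> and \<open>tree\<close> of the library forbid directed cycles only, among them the
  cycle of length two formed by the two arcs of an edge. An undirected cycle is a directed
  cycle of length at least three.
\<close>

definition is_tree :: "('a, 'b) pre_digraph \<Rightarrow> bool" where
  "is_tree T \<longleftrightarrow> graph T \<and> connected T \<and> \<not> (\<exists>p. pre_digraph.cycle T p \<and> length p \<ge> 3)"

text \<open>In a simple graph the degree of a vertex is its number of outgoing arcs.\<close>

definition leaves :: "('a, 'b) pre_digraph \<Rightarrow> 'a set" where
  "leaves T = {v \<in> verts T. out_degree T v = 1}"

definition k_ended_tree_in :: "nat \<Rightarrow> ('a, 'b) pre_digraph \<Rightarrow> ('a, 'b) pre_digraph \<Rightarrow> bool" where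
  "k_ended_tree_in k T G \<longleftrightarrow> subgraph T G \<and> is_tree T \<and> card (leaves T) \<le> k"

end

theory Submission
  imports Defs
begin

text \<open>
  Write \<open>\<alpha>\<close> for the independence number and \<open>\<kappa>\<close> for the connectivity of \<open>S\<close>. The whole weight of
  the proof lies in the case \<open>k = 2\<close>, where a tree is a path \<open>P\<close>; the number of leaves beyond two
  costs almost nothing.

  \<^bold>\<open>From \<open>k\<close> to \<open>k + 1\<close>.\<close> If a tree \<open>T\<close> misses some vertex of \<open>S\<close>, consider the paths that leave \<open>T\<close>,
  avoid it afterwards and end in \<open>S\<close>, and attach a longest one, \<open>Q\<close>. The last vertex of \<open>Q\<close> has no
  neighbour in \<open>S\<close> outside \<open>T\<close> and \<open>Q\<close>, so it can be added to every independent subset of what is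
  still uncovered. Hence one more leaf lowers \<open>\<alpha>(S - V(T))\<close> by at least one
  (\<open>path_reducing_alpha_outside\<close>, \<open>k_ended_tree_attach_path\<close>).

  \<^bold>\<open>Paths.\<close> Let \<open>m\<close> be the minimum of \<open>\<alpha>(S - V(P))\<close> over all paths and assume \<open>m > 0\<close>; the claim is
  \<open>\<alpha>(S) \<ge> m + \<kappa> + 1\<close> (\<open>path_reducing_alpha\<close>). Shrink \<open>S\<close> as long as the minimum stays at least \<open>m\<close>,
  which does not increase \<open>\<alpha>(S)\<close> and does not lower the connectivity. Then for any \<open>v\<close> in \<open>S\<close> there is
  a path \<open>P\<close> avoiding \<open>v\<close> for which \<open>W = S - V(P) - {v}\<close> has \<open>\<alpha>(W) = m - 1\<close>. So every
  path through \<open>v\<close> has to give up vertices of \<open>P\<close> whose addition to \<open>W\<close> raises \<open>\<alpha>(W)\<close>.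

  Menger's theorem (\<open>menger\<close>) gives a fan of paths from \<open>v\<close> to \<open>\<kappa>\<close> vertices \<open>x\<close> of \<open>P\<close>. After each
  \<open>x\<close>, and also at the start of \<open>P\<close>, take the shortest stretch of \<open>P\<close> whose addition to \<open>W\<close> raises
  \<open>\<alpha>\<close>. These stretches end before the next fan vertex, because \<open>P\<close> can be rerouted through
  \<open>v\<close> from one fan vertex to the next. Choose the fan with its ends as late on \<open>P\<close> as possible. Then
  no stretch is connected through \<open>W\<close> to \<open>v\<close> or to another stretch, since a shortest such
  connection permits a rerouting through \<open>v\<close> which gives up only proper initial parts of one or two stretches.
  Therefore the gains add up: the \<open>\<kappa> + 1\<close> stretches and \<open>v\<close> together raise \<open>\<alpha>\<close> from \<open>m - 1\<close>
  to \<open>m + \<kappa> + 1\<close> (\<open>extremal_fan_bound\<close>).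
\<close>

section \<open>Chains and Menger's theorem\<close>

abbreviation chain :: "('a \<times> 'a) set \<Rightarrow> 'a list \<Rightarrow> bool" where
  "chain E \<equiv> successively (\<lambda>u v. (u, v) \<in> E)"

lemma chain_mono: "chain E p \<Longrightarrow> E \<subseteq> F \<Longrightarrow> chain F p"
  by (erule successively_mono) blast

lemma chain_rev: "sym E \<Longrightarrow> chain E (rev p) = chain E p"
  by (metis (mono_tags, lifting) successively_mono successively_rev rev_rev_ident symD)

lemma chain_prefix: "chain E (p @ w # q) \<Longrightarrow> chain E (p @ [w])"
  by (auto simp: successively_append_iff successively_Cons)

lemma chain_suffix: "chain E (p @ q) \<Longrightarrow> chain E q"
  by (simp add: successively_append_iff)

lemma chain_glue: "chain E (p @ [w]) \<Longrightarrow> chain E (w # q) \<Longrightarrow> chain E (p @ w # q)"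
  by (auto simp: successively_append_iff successively_Cons)

lemma chain_drop_arc_source:
  assumes "chain (insert (x, y) E) p" "x \<notin> set (butlast p)"
  shows "chain E p"
  using assms by (induction p rule: induct_list012) auto

lemma chain_drop_arc_target:
  assumes "chain (insert (x, y) E) p" "y \<notin> set (tl p)"
  shows "chain E p"
  using assms by (induction p rule: induct_list012) auto

lemma chain_shortcut:
  assumes "chain E (x # N @ [y])"
  obtains N' where "set N' \<subseteq> set N" "distinct N'" "chain E (x # N' @ [y])"
  using assms
proof (induction "length N" arbitrary: N thesis rule: less_induct)
  case less
  show ?case
  proof (cases "distinct N")
    case False
    then obtain a b c w where N: "N = a @ [w] @ b @ [w] @ c"
      using not_distinct_decomp by blast
    have "chain E ((x # a) @ w # ((b @ [w]) @ c @ [y]))"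
      using less.prems(2) unfolding N by simp
    note all = this
    have "chain E ((w # b) @ w # (c @ [y]))" using chain_suffix[OF all] by simp
    from chain_glue[OF chain_prefix[OF all] chain_suffix[OF this]]
    have "chain E (x # (a @ [w] @ c) @ [y])" by simp
    moreover have "length (a @ [w] @ c) < length N" by (simp add: N)
    ultimately obtain N' where "set N' \<subseteq> set (a @ [w] @ c)" "distinct N'" "chain E (x # N' @ [y])"
      using less.hyps by metis
    then show ?thesis using less.prems(1)[of N'] by (auto simp: N)
  qed (use less.prems in auto)
qed

lemma split_first:
  assumes "set p \<inter> X \<noteq> {}"
  obtains ys z zs where "p = ys @ z # zs" "z \<in> X" "set ys \<inter> X = {}"
proof -
  have "\<exists>z \<in> set p. z \<in> X" using assms by blast
  from split_list_first_prop[OF this] that show ?thesis by blast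
qed

lemma split_last:
  assumes "set p \<inter> X \<noteq> {}"
  obtains ys z zs where "p = ys @ z # zs" "z \<in> X" "set zs \<inter> X = {}"
proof -
  have "\<exists>z \<in> set p. z \<in> X" using assms by blast
  from split_list_last_prop[OF this] that show ?thesis by blast
qed

definition joins :: "('a \<times> 'a) set \<Rightarrow> 'a set \<Rightarrow> 'a set \<Rightarrow> 'a list \<Rightarrow> bool" where
  "joins E A B p \<longleftrightarrow> p \<noteq> [] \<and> chain E p \<and> hd p \<in> A \<and> last p \<in> B"

definition separates :: "('a \<times> 'a) set \<Rightarrow> 'a set \<Rightarrow> 'a set \<Rightarrow> 'a set \<Rightarrow> bool" where
  "separates E A B X \<longleftrightarrow> (\<forall>p. joins E A B p \<longrightarrow> set p \<inter> X \<noteq> {})"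

definition linkage :: "('a \<times> 'a) set \<Rightarrow> 'a set \<Rightarrow> 'a set \<Rightarrow> 'a list set \<Rightarrow> bool" where
  "linkage E A B P \<longleftrightarrow>
     finite P \<and> (\<forall>p \<in> P. joins E A B p \<and> distinct p) \<and> pairwise (\<lambda>p q. set p \<inter> set q = {}) P"

text \<open>
  In a linkage with as many paths as there are terminals in \<open>B\<close>, every terminal is the end of exactly one path, and hence, by
  disjointness, no path runs through a terminal before its end. This makes it possible to glue two
  linkages that end and start in the same set.
\<close>

lemma linkage_ends_onto:
  assumes "linkage E A B P" "finite B" "card P = card B"
  obtains f where "\<And>u. u \<in> B \<Longrightarrow> f u \<in> P" "\<And>u. u \<in> B \<Longrightarrow> last (f u) = u"
    "\<And>p r. p \<in> P \<Longrightarrow> r \<in> set p \<Longrightarrow> r \<in> B \<Longrightarrow> r = last p"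
proof -
  have ne: "p \<noteq> []" and inB: "last p \<in> B" if "p \<in> P" for p
    using assms(1) that unfolding linkage_def joins_def by auto
  have uniq: "p = q" if "p \<in> P" "q \<in> P" "r \<in> set p" "r \<in> set q" for p q r
    using assms(1) that unfolding linkage_def pairwise_def by blast
  have inj: "inj_on last P" using ne uniq by (metis inj_onI last_in_set)
  have onto: "last ` P = B"
    by (rule card_subset_eq) (use assms inB inj in \<open>auto simp: card_image\<close>)
  have "\<forall>u \<in> B. \<exists>p \<in> P. last p = u" using onto by blast
  then obtain f where f: "\<And>u. u \<in> B \<Longrightarrow> f u \<in> P \<and> last (f u) = u" by metis
  have "r = last p" if "p \<in> P" "r \<in> set p" "r \<in> B" for p r
    using f[OF that(3)] uniq[of "f r" p r] that ne by (metis last_in_set)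
  with f that show ?thesis by blast
qed

lemma linkage_starts_onto:
  assumes "linkage E A B P" "finite A" "card P = card A"
  obtains g where "\<And>u. u \<in> A \<Longrightarrow> g u \<in> P" "\<And>u. u \<in> A \<Longrightarrow> hd (g u) = u"
    "\<And>p r. p \<in> P \<Longrightarrow> r \<in> set p \<Longrightarrow> r \<in> A \<Longrightarrow> r = hd p"
proof -
  have ne: "p \<noteq> []" and inA: "hd p \<in> A" if "p \<in> P" for p
    using assms(1) that unfolding linkage_def joins_def by auto
  have uniq: "p = q" if "p \<in> P" "q \<in> P" "r \<in> set p" "r \<in> set q" for p q r
    using assms(1) that unfolding linkage_def pairwise_def by blast
  have inj: "inj_on hd P" using ne uniq by (metis inj_onI hd_in_set)
  have onto: "hd ` P = A"
    by (rule card_subset_eq) (use assms inA inj in \<open>auto simp: card_image\<close>)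
  have "\<forall>u \<in> A. \<exists>p \<in> P. hd p = u" using onto by blast
  then obtain f where f: "\<And>u. u \<in> A \<Longrightarrow> f u \<in> P \<and> hd (f u) = u" by metis
  have "r = hd p" if "p \<in> P" "r \<in> set p" "r \<in> A" for p r
    using f[OF that(3)] uniq[of "f r" p r] that ne by (metis hd_in_set)
  with f that show ?thesis by blast
qed

text \<open>
  Menger's theorem for sets of terminals in a directed graph, by induction on the arcs. When the arc
  \<open>xy\<close> is removed and a separator \<open>X\<close> with fewer than \<open>k\<close> vertices appears, both \<open>X\<close> with \<open>x\<close> and
  \<open>X\<close> with \<open>y\<close> separate \<open>A\<close> from \<open>B\<close> in the full graph, so they have exactly \<open>k\<close> vertices. The
  induction hypothesis links \<open>A\<close> to the former and the latter to \<open>B\<close>. Paths of the two linkages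
  can meet only in \<open>X\<close>, as \<open>X\<close> is a separator, and so they combine along \<open>X\<close> and the arc \<open>xy\<close>.
\<close>

theorem menger:
  assumes "finite E" "finite A"
    and "\<And>X. finite X \<Longrightarrow> separates E A B X \<Longrightarrow> k \<le> card X"
  shows "\<exists>P. linkage E A B P \<and> card P = k"
  using assms
proof (induction E arbitrary: A B rule: finite_induct)
  case empty
  have "separates {} A B (A \<inter> B)"
    unfolding separates_def joins_def
  proof (intro allI impI, elim conjE)
    fix p assume p: "p \<noteq> []" "chain {} p" "hd p \<in> A" "last p \<in> B"
    then have "p = [hd p]" by (cases p) (auto simp: successively_Cons)
    with p show "set p \<inter> (A \<inter> B) \<noteq> {}" by (metis IntI empty_iff hd_in_set last.simps)
  qed
  then have "k \<le> card (A \<inter> B)" using empty by auto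
  then obtain T where T: "T \<subseteq> A \<inter> B" "card T = k" "finite T"
    by (rule obtain_subset_with_card_n)
  have "linkage {} A B ((\<lambda>x. [x]) ` T)"
    using T by (auto simp: linkage_def joins_def pairwise_def)
  moreover have "card ((\<lambda>x. [x]) ` T) = k" using T by (simp add: card_image inj_on_def)
  ultimately show ?case by blast
next
  case (insert e F)
  obtain x y where e: "e = (x, y)" by fastforce
  let ?E = "insert (x, y) F"
  show ?case
  proof (cases "\<forall>X. finite X \<longrightarrow> separates F A B X \<longrightarrow> k \<le> card X")
    case True
    then obtain P where "linkage F A B P" "card P = k" using insert.IH insert.prems by blast
    moreover from this have "linkage ?E A B P"
      unfolding linkage_def joins_def using chain_mono[of F _ ?E] by blast
    ultimately show ?thesis unfolding e by blast
  next
    case False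
    then obtain X where X: "finite X" "separates F A B X" "card X < k" by (meson not_le)
    define X1 where "X1 = insert x X"
    define X2 where "X2 = insert y X"
    have sepX1: "separates ?E A B X1" unfolding separates_def joins_def
    proof (intro allI impI, elim conjE)
      fix p assume p: "p \<noteq> []" "chain ?E p" "hd p \<in> A" "last p \<in> B"
      show "set p \<inter> X1 \<noteq> {}"
      proof (cases "x \<in> set p")
        case False
        then have "chain F p" using chain_drop_arc_source p(2) in_set_butlastD by metis
        then show ?thesis using X p unfolding separates_def joins_def X1_def by blast
      qed (auto simp: X1_def)
    qed
    have sepX2: "separates ?E A B X2" unfolding separates_def joins_def
    proof (intro allI impI, elim conjE)
      fix p assume p: "p \<noteq> []" "chain ?E p" "hd p \<in> A" "last p \<in> B"
      show "set p \<inter> X2 \<noteq> {}"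
      proof (cases "y \<in> set p")
        case False
        then have "chain F p" using chain_drop_arc_target p(2) list.set_sel(2) p(1) by metis
        then show ?thesis using X p unfolding separates_def joins_def X2_def by blast
      qed (auto simp: X2_def)
    qed
    have fin: "finite X1" "finite X2" using X by (auto simp: X1_def X2_def)
    have "k \<le> card X1" "k \<le> card X2" using insert.prems sepX1 sepX2 fin unfolding e by auto
    then have cards: "card X1 = k" "card X2 = k" and xX: "x \<notin> X" and yX: "y \<notin> X"
      using X unfolding X1_def X2_def by (auto simp: card_insert_if split: if_splits)
    have "\<exists>P. linkage F A X1 P \<and> card P = k"
    proof (rule insert.IH)
      fix Z assume Z: "finite Z" "separates F A X1 Z"
      have "separates ?E A B Z" unfolding separates_def
      proof (intro allI impI)
        fix p assume p: "joins ?E A B p"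
        then obtain ys z zs where s: "p = ys @ z # zs" "z \<in> X1" "set ys \<inter> X1 = {}"
          using split_first sepX1 unfolding separates_def by metis
        have "chain ?E (ys @ [z])"
          using p s(1) by (auto simp: joins_def successively_append_iff successively_Cons)
        then have "chain F (ys @ [z])" by (rule chain_drop_arc_source) (use s in \<open>auto simp: X1_def\<close>)
        then have "joins F A X1 (ys @ [z])" using p s by (cases ys) (auto simp: joins_def)
        then show "set p \<inter> Z \<noteq> {}" using Z s(1) unfolding separates_def by fastforce
      qed
      then show "k \<le> card Z" using Z insert.prems unfolding e by blast
    qed (use insert.prems in auto)
    then obtain P1 where P1: "linkage F A X1 P1" "card P1 = k" by blast
    have "\<exists>P. linkage F X2 B P \<and> card P = k"
    proof (rule insert.IH)
      fix Z assume Z: "finite Z" "separates F X2 B Z"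
      have "separates ?E A B Z" unfolding separates_def
      proof (intro allI impI)
        fix p assume p: "joins ?E A B p"
        then obtain ys z zs where s: "p = ys @ z # zs" "z \<in> X2" "set zs \<inter> X2 = {}"
          using split_last sepX2 unfolding separates_def by metis
        have "chain ?E (z # zs)"
          using p s(1) by (auto simp: joins_def successively_append_iff)
        then have "chain F (z # zs)" by (rule chain_drop_arc_target) (use s in \<open>auto simp: X2_def\<close>)
        then have "joins F X2 B (z # zs)" using p s by (auto simp: joins_def)
        then show "set p \<inter> Z \<noteq> {}" using Z s(1) unfolding separates_def by fastforce
      qed
      then show "k \<le> card Z" using Z insert.prems unfolding e by blast
    qed (use fin in auto)
    then obtain P2 where P2: "linkage F X2 B P2" "card P2 = k" by blast
    obtain f where f: "\<And>u. u \<in> X1 \<Longrightarrow> f u \<in> P1" "\<And>u. u \<in> X1 \<Longrightarrow> last (f u) = u"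
      "\<And>p r. p \<in> P1 \<Longrightarrow> r \<in> set p \<Longrightarrow> r \<in> X1 \<Longrightarrow> r = last p"
      using linkage_ends_onto[OF P1(1)] fin P1 cards by metis
    obtain g where g: "\<And>u. u \<in> X2 \<Longrightarrow> g u \<in> P2" "\<And>u. u \<in> X2 \<Longrightarrow> hd (g u) = u"
      "\<And>p r. p \<in> P2 \<Longrightarrow> r \<in> set p \<Longrightarrow> r \<in> X2 \<Longrightarrow> r = hd p"
      using linkage_starts_onto[OF P2(1)] fin P2 cards by metis
    have J1: "joins F A X1 p" "distinct p" if "p \<in> P1" for p
      using P1 that by (auto simp: linkage_def)
    have J2: "joins F X2 B p" "distinct p" if "p \<in> P2" for p
      using P2 that by (auto simp: linkage_def)
    \<comment> \<open>Following \<open>p\<close> up to \<open>t\<close> and \<open>q\<close> from there leads from \<open>A\<close> to \<open>B\<close> without the removed arc, and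
      so meets \<open>X\<close>; but \<open>p\<close> can meet \<open>X\<close> only in its end, and \<open>q\<close> only in its start.\<close>
    have meet: "t = last p \<and> t = hd q \<and> t \<in> X" if pq: "p \<in> P1" "q \<in> P2" "t \<in> set p" "t \<in> set q" for p q t
    proof -
      obtain p1 p2 where p: "p = p1 @ t # p2" using pq(3) by (meson split_list)
      obtain q1 q2 where q: "q = q1 @ t # q2" using pq(4) by (meson split_list)
      have "chain F (p1 @ t # p2)" "chain F (q1 @ t # q2)"
        using J1(1)[OF pq(1)] J2(1)[OF pq(2)] unfolding p q joins_def by blast+
      then have "chain F (p1 @ t # q2)" using chain_glue chain_prefix chain_suffix by metis
      then have "joins F A B (p1 @ t # q2)"
        using J1[OF pq(1)] J2[OF pq(2)] unfolding p q joins_def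
        by (cases p1) auto
      then obtain r where r: "r \<in> set (p1 @ t # q2)" "r \<in> X"
        using X unfolding separates_def by blast
      have "t \<in> X"
      proof (cases "r \<in> set (p1 @ [t])")
        case True
        then have "r \<in> set p" "r \<in> X1" using r p by (auto simp: X1_def)
        then have "r = last p" by (rule f(3)[OF pq(1)])
        then have "r = t" using True J1[OF pq(1)] unfolding p by (cases p2 rule: rev_cases) auto
        then show ?thesis using r by simp
      next
        case False
        then have rq: "r \<in> set (t # q2)" using r by auto
        then have "r \<in> set q" "r \<in> X2" using r q by (auto simp: X2_def)
        then have "r = hd q" by (rule g(3)[OF pq(2)])
        then have "r = t" using rq J2[OF pq(2)] unfolding q by (cases q1) auto
        then show ?thesis using r by simp
      qed
      then have "t \<in> X1" "t \<in> X2" by (auto simp: X1_def X2_def)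
      then show ?thesis using f(3)[OF pq(1,3)] g(3)[OF pq(2,4)] \<open>t \<in> X\<close> by blast
    qed
    \<comment> \<open>The path ending in \<open>u\<close> is continued by the path starting in \<open>s u\<close>: in \<open>u\<close> itself when
      \<open>u\<close> lies in \<open>X\<close>, and in \<open>y\<close> across the removed arc when \<open>u = x\<close>.\<close>
    define s where "s u = (if u = x then y else u)" for u
    define h where "h u = (if u = x then f x @ g y else f u @ tl (g u))" for u
    have s: "s u \<in> X2" if "u \<in> X1" for u using that by (auto simp: s_def X1_def X2_def)
    have set_h: "set (h u) = set (f u) \<union> set (g (s u))" if u: "u \<in> X1" for u
    proof (cases "u = x")
      case False
      then have "u \<in> set (f u)" "u = hd (g u)" "g u \<noteq> []"
        using f(1,2)[OF u] g(1,2)[of u] s[OF u] J1[of "f u"] J2[of "g u"]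
        by (auto simp: s_def joins_def dest: last_in_set)
      then show ?thesis using False by (cases "g u") (auto simp: h_def s_def)
    qed (auto simp: h_def s_def)
    have h_joins: "joins ?E A B (h u) \<and> distinct (h u)" if u: "u \<in> X1" for u
    proof -
      note a = J1[OF f(1)[OF u]] f(2)[OF u] J2[OF g(1)[OF s[OF u]]] g(2)[OF s[OF u]]
      note m = meet[OF f(1)[OF u] g(1)[OF s[OF u]]]
      have ch: "chain ?E (f u)" "chain ?E (g (s u))"
        using a chain_mono[OF _ subset_insertI] unfolding joins_def by blast+
      show ?thesis
      proof (cases "u = x")
        case True
        have "chain ?E (f u @ g y)"
          using a ch True by (auto simp: successively_append_iff joins_def s_def)
        moreover have "set (f x) \<inter> set (g y) = {}"
          using m a True xX by (auto simp: s_def)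
        ultimately show ?thesis using a True by (auto simp: joins_def h_def s_def)
      next
        case False
        then have su: "s u = u" by (simp add: s_def)
        obtain gs where gs: "g u = u # gs" using a su by (cases "g u") (auto simp: joins_def)
        have "chain ?E (f u @ gs)"
          using a ch gs su by (auto simp: successively_append_iff successively_Cons joins_def)
        moreover have "set (f u) \<inter> set gs = {}" using m a su gs by force
        ultimately show ?thesis using a False gs su by (cases "gs = []") (auto simp: joins_def h_def)
      qed
    qed
    have disj: "set (h u) \<inter> set (h w) = {}" if uw: "u \<in> X1" "w \<in> X1" "u \<noteq> w" for u w
    proof -
      have ne_s: "s u \<noteq> s w" using uw yX by (auto simp: s_def X1_def)
      have "f u \<noteq> f w" "g (s u) \<noteq> g (s w)" using uw f(2) g(2) s ne_s by metis+
      then have "set (f u) \<inter> set (f w) = {}" "set (g (s u)) \<inter> set (g (s w)) = {}"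
        using P1 P2 f(1) g(1) uw s unfolding linkage_def pairwise_def by blast+
      moreover have "set (f a) \<inter> set (g (s b)) = {}" if ab: "a \<in> X1" "b \<in> X1" "a \<noteq> b" for a b
      proof (rule ccontr)
        assume "set (f a) \<inter> set (g (s b)) \<noteq> {}"
        then obtain t where "t \<in> set (f a)" "t \<in> set (g (s b))" by blast
        then have "t = a" "t = s b" "t \<in> X" using meet f g s ab by metis+
        then show False using ab yX by (auto simp: s_def split: if_splits)
      qed
      ultimately show ?thesis using set_h uw by (metis (no_types, lifting) Int_Un_distrib Int_Un_distrib2 Int_commute sup_bot.right_neutral)
    qed
    have "linkage ?E A B (h ` X1)"
      using h_joins disj fin unfolding linkage_def pairwise_def by blast
    moreover have "inj_on h X1"
      using disj h_joins unfolding joins_def by (metis Int_absorb inj_onI set_empty)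
    then have "card (h ` X1) = k" using cards by (simp add: card_image)
    ultimately show ?thesis unfolding e by blast
  qed
qed

section \<open>Independence number and unlinked sets\<close>

text \<open>
  Only the inner vertices of the connecting walk have to lie in \<open>W\<close>; in particular an arc from \<open>A\<close>
  to \<open>B\<close> links them.
\<close>

definition linked :: "('a \<times> 'a) set \<Rightarrow> 'a set \<Rightarrow> 'a set \<Rightarrow> 'a set \<Rightarrow> bool" where
  "linked E W A B \<longleftrightarrow> (\<exists>N a b. set N \<subseteq> W \<and> a \<in> A \<and> b \<in> B \<and> chain E (a # N @ [b]))"

lemma linked_sym: "sym E \<Longrightarrow> linked E W A B \<Longrightarrow> linked E W B A"
proof -
  assume E: "sym E" and "linked E W A B"
  then obtain N a b where N: "set N \<subseteq> W" "a \<in> A" "b \<in> B" "chain E (a # N @ [b])"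
    unfolding linked_def by blast
  then have "chain E (rev (a # N @ [b]))" using chain_rev[OF E] by blast
  then have "chain E (b # rev N @ [a])" by simp
  then show ?thesis using N unfolding linked_def by (metis set_rev)
qed

lemma linked_Union: "linked E W A (\<Union>i \<in> J. R i) \<Longrightarrow> \<exists>i \<in> J. linked E W A (R i)"
  unfolding linked_def by blast

context graph
begin

abbreviation \<alpha> :: "'a set \<Rightarrow> nat" where
  "\<alpha> \<equiv> alpha G"

lemma arcs_ends_sym: "sym (arcs_ends G)"
  using sym_arcs by (simp add: symmetric_def)

lemma independent_subset: "independent_in G I \<Longrightarrow> J \<subseteq> I \<Longrightarrow> independent_in G J"
  unfolding independent_in_def by blast

lemma finite_independent: "independent_in G I \<Longrightarrow> finite I"
  unfolding independent_in_def using finite_subset finite_verts by blast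

lemma finite_independent_cards: "finite {card I |I. I \<subseteq> S \<and> independent_in G I}"
proof -
  have "{card I |I. I \<subseteq> S \<and> independent_in G I} \<subseteq> card ` Pow (verts G)"
    by (auto simp: independent_in_def)
  then show ?thesis by (rule finite_subset) simp
qed

lemma alpha_upper: "I \<subseteq> S \<Longrightarrow> independent_in G I \<Longrightarrow> card I \<le> \<alpha> S"
  unfolding alpha_def by (rule Max_ge[OF finite_independent_cards]) blast

lemma alpha_attained:
  obtains I where "I \<subseteq> S" "independent_in G I" "card I = \<alpha> S"
proof -
  have "independent_in G {}" by (simp add: independent_in_def)
  then have "{card I |I. I \<subseteq> S \<and> independent_in G I} \<noteq> {}" by blast
  from Max_in[OF finite_independent_cards this] that show ?thesis
    unfolding alpha_def by auto
qed

lemma alpha_mono: "S \<subseteq> S' \<Longrightarrow> \<alpha> S \<le> \<alpha> S'"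
  by (metis alpha_attained alpha_upper subset_trans)

lemma alpha_empty: "\<alpha> {} = 0"
  by (metis alpha_attained card.empty subset_empty)

lemma alpha_insert_le: "\<alpha> (insert v S) \<le> Suc (\<alpha> S)"
proof -
  obtain I where I: "I \<subseteq> insert v S" "independent_in G I" "card I = \<alpha> (insert v S)"
    by (rule alpha_attained)
  have "card (I - {v}) \<le> \<alpha> S" by (rule alpha_upper) (use I independent_subset in blast)+
  moreover have "card I \<le> Suc (card (I - {v}))"
    using finite_independent[OF I(2)] by (auto simp: card_Diff_singleton_if)
  ultimately show ?thesis using I(3) by simp
qed

lemma alpha_Un_le: "\<alpha> (A \<union> B) \<le> \<alpha> A + \<alpha> B"
proof -
  obtain I where I: "I \<subseteq> A \<union> B" "independent_in G I" "card I = \<alpha> (A \<union> B)"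
    by (rule alpha_attained)
  have "card I \<le> card (I \<inter> A) + card (I \<inter> B)"
    using card_Un_le[of "I \<inter> A" "I \<inter> B"] I(1) by (metis Int_Un_distrib inf.absorb1)
  moreover have "card (I \<inter> A) \<le> \<alpha> A" "card (I \<inter> B) \<le> \<alpha> B"
    using I by (auto intro!: alpha_upper independent_subset[of I])
  ultimately show ?thesis using I(3) by linarith
qed

lemma alpha_Un:
  assumes "A \<inter> B = {}" and "\<And>a b. a \<in> A \<Longrightarrow> b \<in> B \<Longrightarrow> \<not> a \<rightarrow> b"
  shows "\<alpha> (A \<union> B) = \<alpha> A + \<alpha> B"
proof (rule antisym[OF alpha_Un_le])
  obtain I where I: "I \<subseteq> A" "independent_in G I" "card I = \<alpha> A" by (rule alpha_attained)
  obtain J where J: "J \<subseteq> B" "independent_in G J" "card J = \<alpha> B" by (rule alpha_attained)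
  have "\<not> b \<rightarrow> a" if "a \<in> A" "b \<in> B" for a b
    using assms(2)[OF that] graph_symmetric by blast
  then have "independent_in G (I \<union> J)"
    using I J assms(2) unfolding independent_in_def by blast
  moreover have "card (I \<union> J) = card I + card J"
    using I J assms(1) finite_independent by (intro card_Un_disjoint) auto
  ultimately show "\<alpha> A + \<alpha> B \<le> \<alpha> (A \<union> B)"
    using I J alpha_upper[of "I \<union> J" "A \<union> B"] by auto
qed

text \<open>
  The set \<open>C\<close> consisting of \<open>R\<close> and of all that is reachable from it inside \<open>W\<close> is adjacent neither to
  the rest of \<open>W\<close> nor to \<open>R'\<close>. All four independence numbers therefore split into a part inside \<open>C\<close>
  and a part outside it, and these parts agree on both sides of the equation.
\<close>

lemma alpha_modular:
  assumes disj: "R \<inter> W = {}" "R' \<inter> W = {}" "R \<inter> R' = {}"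
    and nl: "\<not> linked (arcs_ends G) W R R'"
  shows "\<alpha> (W \<union> R \<union> R') + \<alpha> W = \<alpha> (W \<union> R) + \<alpha> (W \<union> R')"
proof -
  define C where "C = R \<union> {w \<in> W. \<exists>N a. set N \<subseteq> W \<and> a \<in> R \<and> chain (arcs_ends G) (a # N @ [w])}"
  have from_C: "\<exists>N a. set N \<subseteq> W \<and> a \<in> R \<and> chain (arcs_ends G) (a # N @ [d])"
    if c: "c \<in> C" "c \<rightarrow> d" for c d
  proof (cases "c \<in> R")
    case True
    then show ?thesis using c by (intro exI[of _ "[]"] exI[of _ c]) auto
  next
    case False
    then obtain N a where N: "c \<in> W" "set N \<subseteq> W" "a \<in> R" "chain (arcs_ends G) (a # N @ [c])"
      using c(1) unfolding C_def by auto
    have "chain (arcs_ends G) ((a # N) @ c # [d])"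
      by (rule chain_glue) (use N c in auto)
    then show ?thesis using N by (intro exI[of _ "N @ [c]"] exI[of _ a]) auto
  qed
  have sep: "\<not> c \<rightarrow> d" if "c \<in> C" "d \<in> W - C \<union> R'" for c d
  proof
    assume "c \<rightarrow> d"
    from from_C[OF that(1) this] obtain N a
      where N: "set N \<subseteq> W" "a \<in> R" "chain (arcs_ends G) (a # N @ [d])" by blast
    have "d \<notin> R'"
    proof
      assume "d \<in> R'"
      with N have "linked (arcs_ends G) W R R'"
        unfolding linked_def by (intro exI[of _ N] exI[of _ a] exI[of _ d]) simp
      with nl show False by simp
    qed
    moreover have "d \<in> C" if "d \<in> W"
      unfolding C_def using N that by (intro UnI2 CollectI conjI exI[of _ N] exI[of _ a])
    ultimately show False using that(2) by blast
  qed
  have CW: "R \<subseteq> C" "C \<subseteq> R \<union> W" by (auto simp: C_def)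
  have "\<alpha> (C \<union> (W - C \<union> R')) = \<alpha> C + \<alpha> (W - C \<union> R')"
    by (rule alpha_Un[OF _ sep]) (use CW disj in blast)+
  moreover have "\<alpha> ((W \<inter> C) \<union> (W - C)) = \<alpha> (W \<inter> C) + \<alpha> (W - C)"
    by (rule alpha_Un[OF _ sep]) blast+
  moreover have "\<alpha> (C \<union> (W - C)) = \<alpha> C + \<alpha> (W - C)"
    by (rule alpha_Un[OF _ sep]) blast+
  moreover have "\<alpha> ((W \<inter> C) \<union> (W - C \<union> R')) = \<alpha> (W \<inter> C) + \<alpha> (W - C \<union> R')"
    by (rule alpha_Un[OF _ sep]) (use disj in blast)+
  moreover have "C \<union> (W - C \<union> R') = W \<union> R \<union> R'" "(W \<inter> C) \<union> (W - C) = W"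
    "C \<union> (W - C) = W \<union> R" "(W \<inter> C) \<union> (W - C \<union> R') = W \<union> R'"
    using CW by blast+
  ultimately show ?thesis by simp
qed

text \<open>
  Pairwise unlinked sets raise the independence number independently of each other. This is where
  the lower bound on \<open>\<alpha>(S)\<close> finally comes from.
\<close>

lemma alpha_Union_regions:
  assumes "finite J"
    and "\<And>i. i \<in> J \<Longrightarrow> R i \<inter> W = {}"
    and "\<And>i j. i \<in> J \<Longrightarrow> j \<in> J \<Longrightarrow> i \<noteq> j \<Longrightarrow> R i \<inter> R j = {}"
    and "\<And>i j. i \<in> J \<Longrightarrow> j \<in> J \<Longrightarrow> i \<noteq> j \<Longrightarrow> \<not> linked (arcs_ends G) W (R i) (R j)"
    and "\<And>i. i \<in> J \<Longrightarrow> \<alpha> W < \<alpha> (W \<union> R i)"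
  shows "\<alpha> W + card J \<le> \<alpha> (W \<union> (\<Union>i \<in> J. R i))"
  using assms
proof (induction J rule: finite_induct)
  case (insert i J)
  have "\<not> linked (arcs_ends G) W (R i) (\<Union>j \<in> J. R j)"
    using linked_Union[of "arcs_ends G" W "R i" R J] insert.hyps insert.prems(3) by blast
  then have "\<alpha> (W \<union> R i \<union> (\<Union>j \<in> J. R j)) + \<alpha> W = \<alpha> (W \<union> R i) + \<alpha> (W \<union> (\<Union>j \<in> J. R j))"
    using insert.hyps insert.prems(1,2) by (intro alpha_modular) blast+
  moreover have "\<alpha> W + card J \<le> \<alpha> (W \<union> (\<Union>j \<in> J. R j))"
    using insert.prems by (intro insert.IH) auto
  moreover have "\<alpha> W < \<alpha> (W \<union> R i)" using insert.prems by simp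
  ultimately show ?case using insert.hyps by (simp add: Un_assoc)
qed simp

end

section \<open>Rerouting a path through a fan\<close>

definition seg :: "'a list \<Rightarrow> nat \<Rightarrow> nat \<Rightarrow> 'a set" where
  "seg P i t = set (drop i (take t P))"

lemma seg_conv_nth: "seg P i t = {P ! u | u. i \<le> u \<and> u < t \<and> u < length P}"
proof -
  have "x \<in> seg P i t \<longleftrightarrow> (\<exists>u. i \<le> u \<and> u < t \<and> u < length P \<and> x = P ! u)" for x
  proof
    assume "x \<in> seg P i t"
    then obtain k where "k < length (drop i (take t P))" "x = drop i (take t P) ! k"
      unfolding seg_def by (metis in_set_conv_nth)
    moreover from this(1) have "i \<le> length (take t P)" by (simp only: length_drop)
    ultimately show "\<exists>u. i \<le> u \<and> u < t \<and> u < length P \<and> x = P ! u"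
      by (intro exI[of _ "i + k"]) auto
  next
    assume "\<exists>u. i \<le> u \<and> u < t \<and> u < length P \<and> x = P ! u"
    then obtain u where "i \<le> u" "u < t" "u < length P" "x = P ! u" by blast
    then show "x \<in> seg P i t"
      unfolding seg_def in_set_conv_nth by (intro exI[of _ "u - i"]) auto
  qed
  then show ?thesis by blast
qed

lemma seg_subset: "seg P i t \<subseteq> set P"
  by (auto simp: seg_conv_nth)

lemma seg_disjoint: "distinct P \<Longrightarrow> t \<le> j \<Longrightarrow> seg P i t \<inter> seg P j u = {}"
  by (auto simp: seg_conv_nth nth_eq_iff_index_eq)

lemma split_at_nth:
  assumes "i \<le> t" "t < length P"
  shows "P = take i P @ drop i (take t P) @ P ! t # drop (Suc t) P"
proof -
  have "take i P @ drop i (take t P) = take t P"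
    using append_take_drop_id[of i "take t P"] assms by (simp add: min_def)
  then show ?thesis using id_take_nth_drop[OF assms(2)] by (metis append_assoc)
qed

lemma chain_append_left: "chain E (p @ q) \<Longrightarrow> chain E p"
  by (simp add: successively_append_iff)

lemma chain_take: "chain E p \<Longrightarrow> chain E (take t p)"
  by (metis append_take_drop_id chain_append_left)

context graph
begin

text \<open>
  The empty list counts as a path, so that there is always some path to start from when one with a
  minimal uncovered part is chosen.
\<close>

definition gpath :: "'a list \<Rightarrow> bool" where
  "gpath p \<longleftrightarrow> distinct p \<and> set p \<subseteq> verts G \<and> chain (arcs_ends G) p"

text \<open>
  A fan from \<open>v\<close> to \<open>P\<close> is indexed by the positions at which it cuts \<open>P\<close>: a positive \<open>i\<close> in \<open>I\<close> stands
  for the fan path that joins the vertex with index \<open>i - 1\<close>, the last one of \<open>take i P\<close>, to \<open>v\<close> with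
  inner vertices \<open>L i\<close>. The position \<open>0\<close> is always present with no inner vertices. It stands for a
  path that begins in \<open>v\<close>, as if a further vertex in front of \<open>P\<close> were adjacent to \<open>v\<close>. In
  this way the stretch at the start of \<open>P\<close> is treated like those after the ends of the fan.
\<close>

definition fan :: "'a \<Rightarrow> 'a list \<Rightarrow> nat set \<Rightarrow> (nat \<Rightarrow> 'a list) \<Rightarrow> bool" where
  "fan v P I L \<longleftrightarrow> 0 \<in> I \<and> I \<subseteq> {..length P} \<and> L 0 = [] \<and>
     (\<forall>i \<in> I. distinct (L i) \<and> set (L i) \<subseteq> verts G - insert v (set P) \<and>
        chain (arcs_ends G) (take i P @ L i @ [v])) \<and>
     (\<forall>i \<in> I. \<forall>j \<in> I. i \<noteq> j \<longrightarrow> set (L i) \<inter> set (L j) = {})"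

lemma chain_rev_arcs: "chain (arcs_ends G) (rev p) = chain (arcs_ends G) p"
  by (rule chain_rev[OF arcs_ends_sym])

text \<open>
  Rerouting \<open>P = A B z D\<close> through \<open>v\<close> gives up only the vertices of \<open>B\<close>.
\<close>

lemma gpath_detour:
  assumes P: "gpath P" "P = A @ B @ z # D" and v: "v \<in> verts G" "v \<notin> set P"
    and K: "chain (arcs_ends G) (A @ K @ [v])" "distinct K" "set K \<subseteq> verts G - insert v (set P)"
    and M: "chain (arcs_ends G) (v # M @ [z])" "distinct M" "set M \<subseteq> verts G - insert v (set P)"
    and "set K \<inter> set M = {}"
  shows "gpath (A @ K @ v # M @ z # D)"
proof -
  have dP: "distinct (A @ B @ z # D)" "set (A @ B @ z # D) \<subseteq> verts G"
    using P(1) unfolding P(2) gpath_def by blast+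
  have "chain (arcs_ends G) (z # D)"
    using P chain_suffix[of _ "A @ B"] unfolding gpath_def by simp
  with M(1) have "chain (arcs_ends G) ((v # M) @ z # D)" using chain_glue[of _ "v # M" z D] by simp
  then have "chain (arcs_ends G) ((A @ K) @ v # (M @ z # D))"
    using K(1) chain_glue[of _ "A @ K" v "M @ z # D"] by simp
  moreover have "distinct (A @ K @ v # M @ z # D)" "set (A @ K @ v # M @ z # D) \<subseteq> verts G"
    using dP v K(2,3) M(2,3) assms(11) unfolding P(2) by auto
  ultimately show ?thesis unfolding gpath_def by simp
qed

text \<open>
  Rerouting \<open>P = A B x C D z F\<close> along \<open>A\<close>, through \<open>v\<close> to the end of \<open>C\<close>, back along \<open>C\<close> to \<open>x\<close>, and
  across \<open>N\<close> to \<open>z\<close> gives up only the vertices of \<open>B\<close> and \<open>D\<close>.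
\<close>

lemma gpath_double_detour:
  assumes P: "gpath P" "P = A @ B @ x # C @ D @ z # F" and v: "v \<in> verts G" "v \<notin> set P"
    and K: "chain (arcs_ends G) (A @ K @ [v])" "distinct K" "set K \<subseteq> verts G - insert v (set P)"
    and M: "chain (arcs_ends G) ((A @ B @ x # C) @ M @ [v])" "distinct M" "set M \<subseteq> verts G - insert v (set P)"
    and N: "chain (arcs_ends G) (x # N @ [z])" "distinct N" "set N \<subseteq> verts G - insert v (set P)"
    and "set K \<inter> set M = {}" "set K \<inter> set N = {}" "set M \<inter> set N = {}"
  shows "gpath (A @ K @ v # rev M @ rev C @ x # N @ z # F)"
proof -
  have dP: "distinct (A @ B @ x # C @ D @ z # F)" "set (A @ B @ x # C @ D @ z # F) \<subseteq> verts G"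
    using P(1) unfolding P(2) gpath_def by blast+
  have "chain (arcs_ends G) (z # F)"
    using P chain_suffix[of _ "A @ B @ x # C @ D"] unfolding gpath_def by simp
  with N(1) have c: "chain (arcs_ends G) ((x # N) @ z # F)" using chain_glue[of _ "x # N" z F] by simp
  have "chain (arcs_ends G) (x # C @ M @ [v])"
    using M(1) chain_suffix[of _ "A @ B"] by simp
  then have "chain (arcs_ends G) (rev (x # C @ M @ [v]))" by (simp only: chain_rev_arcs)
  then have "chain (arcs_ends G) ((v # rev M @ rev C) @ [x])" by simp
  then have "chain (arcs_ends G) ((v # rev M @ rev C) @ x # N @ z # F)"
    by (rule chain_glue) (use c in simp)
  then have "chain (arcs_ends G) ((A @ K) @ v # (rev M @ rev C @ x # N @ z # F))"
    using K(1) chain_glue[of _ "A @ K" v "rev M @ rev C @ x # N @ z # F"] by simp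
  moreover have "distinct (A @ K @ v # rev M @ rev C @ x # N @ z # F)"
    "set (A @ K @ v # rev M @ rev C @ x # N @ z # F) \<subseteq> verts G"
    using dP v K(2,3) M(2,3) N(2,3) assms(14-16) unfolding P(2) by auto
  ultimately show ?thesis unfolding gpath_def by simp
qed

lemma fanD:
  assumes "fan v P I L" "i \<in> I"
  shows "i \<le> length P" "distinct (L i)" "set (L i) \<subseteq> verts G - insert v (set P)"
    "chain (arcs_ends G) (take i P @ L i @ [v])"
    "j \<in> I \<Longrightarrow> i \<noteq> j \<Longrightarrow> set (L i) \<inter> set (L j) = {}"
  using assms unfolding fan_def by auto

text \<open>
  The end of one fan path moves to the vertex with index \<open>t\<close>, that is, to the cut position \<open>Suc t\<close>.
\<close>

lemma fan_exchange:
  assumes P: "gpath P" and F: "fan v P I L" "i \<in> I" "i \<noteq> 0"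
    and t: "t < length P" "Suc t \<notin> I"
    and M: "chain (arcs_ends G) (P ! t # M @ [v])" "distinct M" "set M \<subseteq> verts G - insert v (set P)"
    and disj: "\<And>l. l \<in> I \<Longrightarrow> l \<noteq> i \<Longrightarrow> set (L l) \<inter> set M = {}"
  shows "fan v P (insert (Suc t) (I - {i})) (L(Suc t := M))"
proof -
  have "chain (arcs_ends G) (take t P @ P ! t # drop (Suc t) P)"
    using P id_take_nth_drop[OF t(1)] unfolding gpath_def by metis
  from chain_glue[OF chain_prefix[OF this] M(1)]
  have "chain (arcs_ends G) (take (Suc t) P @ M @ [v])"
    using t(1) by (simp add: take_Suc_conv_app_nth)
  then show ?thesis using F t M disj unfolding fan_def by (auto simp: Int_commute)
qed

text \<open>
  The core of the proof. With \<open>W\<close> for the vertices of \<open>S\<close> missed by \<open>P\<close> other than \<open>v\<close>, the number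
  \<open>a i t\<close> bounds what remains uncovered when \<open>v\<close> is gained at the price of the stretch of \<open>P\<close> from
  index \<open>i\<close> up to, but not including, \<open>t\<close>. The stretch belonging to the cut \<open>i\<close> ends at \<open>y i\<close>, the
  first place where this number reaches \<open>m\<close>. Every path through \<open>v\<close> leaves at least \<open>m\<close> (\<open>gain\<close>),
  whereas proper initial parts of stretches do not raise \<open>\<alpha>(W) = m - 1\<close> (\<open>below_y\<close>). The second conclusion holds because each
  stretch contains a vertex of \<open>S\<close>.
\<close>

lemma extremal_fan_bound:
  assumes P: "gpath P" and v: "v \<in> S" "v \<notin> set P" and S: "S \<subseteq> verts G"
    and m: "\<And>R. gpath R \<Longrightarrow> m \<le> \<alpha> (S - set R)"
    and crit: "\<alpha> (S - set P - {v}) < m"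
    and F: "fan v P I L"
    and extremal: "\<And>I' L'. fan v P I' L' \<Longrightarrow> card I' = card I \<Longrightarrow> \<Sum>I' \<le> \<Sum>I"
  shows "m + card I \<le> \<alpha> S" and "card I \<le> card (S \<inter> set P)"
proof -
  define W where "W = S - set P - {v}"
  define a where "a i t = \<alpha> (W \<union> (S \<inter> seg P i t))" for i t
  have vG: "v \<in> verts G" using v S by blast
  have finI: "finite I" using F finite_subset unfolding fan_def by blast
  have W_off: "W \<subseteq> verts G - insert v (set P)" using S by (auto simp: W_def)
  have aW: "Suc (\<alpha> W) = m"
  proof -
    have "S - set P = insert v W" using v by (auto simp: W_def)
    then have "m \<le> Suc (\<alpha> W)" using m[OF P] alpha_insert_le[of v W] by simp
    then show ?thesis using crit by (simp add: W_def)
  qed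
  have gain: "m \<le> \<alpha> (W \<union> (S \<inter> X))" if "gpath R" "v \<in> set R" "set P \<subseteq> set R \<union> X" for R X
  proof -
    have "S - set R \<subseteq> W \<union> (S \<inter> X)" using that by (auto simp: W_def)
    then show ?thesis using m[OF that(1)] alpha_mono le_trans by blast
  qed
  have detour: "m \<le> a i t"
    if i: "i \<in> I" "i \<le> t" "t < length P" and M: "chain (arcs_ends G) (v # M @ [P ! t])" "distinct M"
      "set M \<subseteq> verts G - insert v (set P)" "set (L i) \<inter> set M = {}" for i t M
  proof -
    note f = fanD[OF F i(1)]
    note s = split_at_nth[OF i(2,3)]
    have "gpath (take i P @ L i @ v # M @ P ! t # drop (Suc t) P)"
      by (rule gpath_detour[OF P s vG v(2) f(4) f(2) f(3) M])
    moreover have "set P \<subseteq> set (take i P @ L i @ v # M @ P ! t # drop (Suc t) P) \<union> seg P i t"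
      using arg_cong[OF s, of set] unfolding seg_def by auto
    ultimately show ?thesis unfolding a_def by (intro gain) auto
  qed
  have detour_end: "m \<le> a i (length P)" if i: "i \<in> I" for i
  proof -
    note f = fanD[OF F i]
    have "set (take i P) \<subseteq> set P" by (rule set_take_subset)
    then have "gpath (take i P @ L i @ [v])"
      using f P vG v(2) unfolding gpath_def by auto
    moreover have "set P \<subseteq> set (take i P @ L i @ [v]) \<union> seg P i (length P)"
      using set_append[of "take i P" "drop i P"] unfolding seg_def by (simp add: subset_iff)
    ultimately show ?thesis unfolding a_def by (intro gain) auto
  qed
  \<comment> \<open>Leave \<open>P\<close> at the cut \<open>i\<close> and come back to the end of the fan path of the later cut \<open>j\<close>, which
    has index \<open>j - 1\<close>: the stretch of \<open>i\<close> stops before it.\<close>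
  have detour_back: "m \<le> a i (j - 1)" if ij: "i \<in> I" "j \<in> I" "i < j" for i j
  proof (rule detour)
    note f = fanD[OF F ij(2)]
    have j: "j - 1 < length P" "Suc (j - 1) = j" using ij f(1) by auto
    have "take j P = take (j - 1) P @ [P ! (j - 1)]"
      using take_Suc_conv_app_nth[OF j(1)] j(2) by simp
    then have "chain (arcs_ends G) (P ! (j - 1) # L j @ [v])"
      using f(4) chain_suffix[of _ "take (j - 1) P"] by simp
    then have "chain (arcs_ends G) (rev (P ! (j - 1) # L j @ [v]))" by (simp only: chain_rev_arcs)
    then show "chain (arcs_ends G) (v # rev (L j) @ [P ! (j - 1)])" by simp
    show "distinct (rev (L j))" "set (rev (L j)) \<subseteq> verts G - insert v (set P)" using f by auto
    show "set (L i) \<inter> set (rev (L j)) = {}" using fanD(5)[OF F ij(1,2)] ij(3) by simp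
    show "i \<le> j - 1" using ij by simp
    show "j - 1 < length P" by (rule j(1))
  qed (rule ij(1))
  define y where "y i = (LEAST t. m \<le> a i t)" for i
  have y: "m \<le> a i (y i)" "y i \<le> length P" if "i \<in> I" for i
    using LeastI[of "\<lambda>t. m \<le> a i t"] Least_le[of "\<lambda>t. m \<le> a i t"] detour_end[OF that]
    unfolding y_def by blast+
  have below_y: "a i t = \<alpha> W" if "t < y i" for i t
  proof -
    have "a i t < m" using not_less_Least that unfolding y_def by (metis not_le)
    moreover have "\<alpha> W \<le> a i t" unfolding a_def by (rule alpha_mono) blast
    ultimately show ?thesis using aW by simp
  qed
  have y_le: "y i < j" if "i \<in> I" "j \<in> I" "i < j" for i j
    using Least_le[of "\<lambda>t. m \<le> a i t", OF detour_back[OF that]] that unfolding y_def by simp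
  \<comment> \<open>A stretch is not connected to \<open>v\<close> off \<open>P\<close>: where such a connection first meets the fan, it could
    continue along that fan path to \<open>v\<close>. If this is a path other than the one of \<open>i\<close> itself, a
    rerouting results that is too cheap; otherwise the fan has an end further down \<open>P\<close>.\<close>
  have no_detour: False
    if i: "i \<in> I" "i \<le> t" "t < y i"
      and N: "chain (arcs_ends G) (P ! t # N @ [v])" "distinct N" "set N \<subseteq> verts G - insert v (set P)"
    for i t N
  proof -
    have t: "t < length P" using y(2)[OF i(1)] i(3) by simp
    have clear: False if M: "chain (arcs_ends G) (P ! t # M @ [v])" "distinct M"
      "set M \<subseteq> verts G - insert v (set P)" "set (L i) \<inter> set M = {}" for M
    proof -
      have "chain (arcs_ends G) (rev (P ! t # M @ [v]))" using M(1) by (simp only: chain_rev_arcs)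
      then have "m \<le> a i t" using M by (intro detour[OF i(1,2) t, of "rev M"]) simp_all
      then show False using below_y[OF i(3)] aW by simp
    qed
    show False
    proof (cases "set N \<inter> (\<Union>l \<in> I. set (L l)) = {}")
      case True
      then show ?thesis using clear[OF N] i(1) by blast
    next
      case False
      then obtain N1 w N2 where N12: "N = N1 @ w # N2" "w \<in> (\<Union>l \<in> I. set (L l))"
        "set N1 \<inter> (\<Union>l \<in> I. set (L l)) = {}"
        by (rule split_first)
      then obtain l where l: "l \<in> I" "w \<in> set (L l)" by blast
      note f = fanD[OF F l(1)]
      obtain A B where AB: "L l = A @ w # B" using l(2) by (meson split_list)
      define M where "M = N1 @ w # B"
      have c1: "chain (arcs_ends G) ((P ! t # N1) @ w # (N2 @ [v]))" using N(1) N12(1) by simp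
      have c2: "chain (arcs_ends G) ((take l P @ A) @ w # (B @ [v]))" using f(4) AB by simp
      have "chain (arcs_ends G) ((P ! t # N1) @ w # (B @ [v]))"
        by (rule chain_glue[OF chain_prefix[OF c1] chain_suffix[OF c2]])
      then have M1: "chain (arcs_ends G) (P ! t # M @ [v])" by (simp add: M_def)
      have N1: "set N1 \<inter> set (L k) = {}" if "k \<in> I" for k using N12(3) that by blast
      have M2: "distinct M" using N(2) N12(1) f(2) N1[OF l(1)] unfolding M_def AB by auto
      have M3: "set M \<subseteq> verts G - insert v (set P)"
        using N(3) N12(1) f(3) unfolding M_def AB by auto
      have M4: "set (L k) \<inter> set M = {}" if "k \<in> I" "k \<noteq> l" for k
      proof -
        have "set (L l) \<inter> set (L k) = {}" using f(5)[OF that(1)] that(2) by blast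
        then show ?thesis using N1[OF that(1)] unfolding M_def AB by auto
      qed
      show False
      proof (cases "l = i")
        case False
        then show ?thesis using clear[OF M1 M2 M3] M4[OF i(1)] by blast
      next
        case True
        have "i \<noteq> 0" using l True F unfolding fan_def by (cases i) auto
        \<comment> \<open>Here the fan path of \<open>i\<close> is redirected to the vertex with index \<open>t\<close>, against the extremal choice.\<close>
        have new: "Suc t \<notin> I" using y_le[OF i(1), of "Suc t"] i by force
        have "fan v P (insert (Suc t) (I - {i})) (L(Suc t := M))"
          by (rule fan_exchange[OF P F i(1) \<open>i \<noteq> 0\<close> t new M1 M2 M3]) (use M4 True in simp)
        moreover have "card (insert (Suc t) (I - {i})) = card I"
          using new card_Suc_Diff1[OF finI i(1)] finI by (metis DiffD1 card_insert_disjoint finite_Diff)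
        ultimately have "\<Sum>(insert (Suc t) (I - {i})) \<le> \<Sum>I" by (rule extremal)
        moreover have "\<Sum>(insert (Suc t) (I - {i})) = Suc t + \<Sum>(I - {i})"
          using new finI by simp
        moreover have "\<Sum>I = i + \<Sum>(I - {i})" by (rule sum.remove[OF finI i(1)])
        ultimately show False using i(2) by simp
      qed
    qed
  qed
  \<comment> \<open>Two stretches are not linked through \<open>W\<close>. In a link with the least \<open>s + t\<close> the initial parts in
    front of \<open>s\<close> and \<open>t\<close> are not linked to each other, so giving up both of them costs nothing, while
    the link allows a rerouting through \<open>v\<close> that gives up nothing else.\<close>
  have no_cross: False
    if ij: "i \<in> I" "j \<in> I" "i < j" and st: "i \<le> s" "s < y i" "j \<le> t" "t < y j"
      and N: "set N \<subseteq> W" "chain (arcs_ends G) (P ! s # N @ [P ! t])" for i j s t N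
    using st N
  proof (induction "s + t" arbitrary: s t N rule: less_induct)
    case less
    obtain N' where N': "set N' \<subseteq> set N" "distinct N'" "chain (arcs_ends G) (P ! s # N' @ [P ! t])"
      using less.prems(6) by (rule chain_shortcut)
    have N'W: "set N' \<subseteq> W" using N'(1) less.prems(5) by blast
    \<comment> \<open>A link meeting the fan would connect a stretch to \<open>v\<close>.\<close>
    have clear: "set (L l) \<inter> set N' = {}" if l: "l \<in> I" for l
    proof (rule ccontr)
      assume "set (L l) \<inter> set N' \<noteq> {}"
      then obtain w where w: "w \<in> set (L l)" "w \<in> set N'" by blast
      note f = fanD[OF F l]
      obtain A B where AB: "L l = A @ w # B" using w(1) by (meson split_list)
      obtain N1 N2 where N12: "N' = N1 @ w # N2" using w(2) by (meson split_list)
      have c1: "chain (arcs_ends G) ((P ! s # N1) @ w # (N2 @ [P ! t]))" using N'(3) N12 by simp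
      have c2: "chain (arcs_ends G) ((take l P @ A) @ w # (B @ [v]))" using f(4) AB by simp
      have "chain (arcs_ends G) ((P ! s # N1) @ w # (B @ [v]))"
        by (rule chain_glue[OF chain_prefix[OF c1] chain_suffix[OF c2]])
      then have "chain (arcs_ends G) (P ! s # (N1 @ w # B) @ [v])" by simp
      then obtain M where M: "set M \<subseteq> set (N1 @ w # B)" "distinct M"
        "chain (arcs_ends G) (P ! s # M @ [v])"
        by (rule chain_shortcut)
      have "set (N1 @ w # B) \<subseteq> verts G - insert v (set P)"
        using N'W W_off f(3) unfolding N12 AB by auto
      then show False using no_detour[OF ij(1) less.prems(1,2) M(3,2)] M(1) by blast
    qed
    have sj: "s < j" using y_le[OF ij] less.prems(2) by simp
    have t: "t < length P" using y(2)[OF ij(2)] less.prems(4) by simp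
    note fi = fanD[OF F ij(1)] and fj = fanD[OF F ij(2)]
    have s1: "take j P = take i P @ drop i (take s P) @ P ! s # drop (Suc s) (take j P)"
      using split_at_nth[of i s "take j P"] less.prems(1) sj fj(1) ij(3) by (simp add: min_def)
    have s2: "P = take i P @ drop i (take s P) @ P ! s # drop (Suc s) (take j P)
        @ drop j (take t P) @ P ! t # drop (Suc t) P"
      using split_at_nth[OF less.prems(3) t] s1 by (metis append_assoc append_Cons)
    let ?R = "take i P @ L i @ v # rev (L j) @ rev (drop (Suc s) (take j P)) @ P ! s # N'
        @ P ! t # drop (Suc t) P"
    have "gpath ?R"
    proof (rule gpath_double_detour[OF P s2 vG v(2) fi(4) fi(2) fi(3) _ fj(2) fj(3) N'(3) N'(2)])
      show "chain (arcs_ends G) ((take i P @ drop i (take s P) @ P ! s # drop (Suc s) (take j P)) @ L j @ [v])"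
        using fj(4) s1 by simp
      show "set N' \<subseteq> verts G - insert v (set P)" using N'W W_off by blast
      show "set (L i) \<inter> set (L j) = {}" using fi(5)[OF ij(2)] ij(3) by simp
    qed (use clear ij in blast)+
    moreover have "set P \<subseteq> set ?R \<union> (seg P i s \<union> seg P j t)"
      using arg_cong[OF s2, of set] unfolding seg_def by auto
    ultimately have "m \<le> \<alpha> (W \<union> (S \<inter> (seg P i s \<union> seg P j t)))"
      by (intro gain) auto
    moreover have "\<alpha> (W \<union> S \<inter> seg P i s \<union> S \<inter> seg P j t) + \<alpha> W
        = \<alpha> (W \<union> S \<inter> seg P i s) + \<alpha> (W \<union> S \<inter> seg P j t)"
    proof (rule alpha_modular)
      show "S \<inter> seg P i s \<inter> W = {}" "S \<inter> seg P j t \<inter> W = {}"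
        using seg_subset[of P] by (auto simp: W_def)
      show "S \<inter> seg P i s \<inter> (S \<inter> seg P j t) = {}"
        using seg_disjoint[of P s j i t] P sj unfolding gpath_def by auto
      show "\<not> linked (arcs_ends G) W (S \<inter> seg P i s) (S \<inter> seg P j t)"
      proof
        assume "linked (arcs_ends G) W (S \<inter> seg P i s) (S \<inter> seg P j t)"
        then obtain N s' t' where *: "set N \<subseteq> W" "i \<le> s'" "s' < s" "j \<le> t'" "t' < t"
          "chain (arcs_ends G) (P ! s' # N @ [P ! t'])"
          unfolding linked_def seg_conv_nth by blast
        show False
          by (rule less.hyps[of s' t' N]) (use * less.prems in auto)
      qed
    qed
    moreover have "\<alpha> (W \<union> S \<inter> seg P i s) = \<alpha> W" "\<alpha> (W \<union> S \<inter> seg P j t) = \<alpha> W"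
      using below_y less.prems unfolding a_def by auto
    ultimately show False using aW by (simp add: Int_Un_distrib Un_assoc)
  qed
  define R where "R i = S \<inter> seg P i (y i)" for i
  have R_W: "R i \<inter> W = {}" for i using seg_subset[of P] by (auto simp: R_def W_def)
  have R_lt: "R i \<inter> R j = {}" "\<not> linked (arcs_ends G) W (R i) (R j)"
    if ij: "i \<in> I" "j \<in> I" "i < j" for i j
  proof -
    show "R i \<inter> R j = {}"
      using seg_disjoint[of P "y i" j i "y j"] P y_le[OF ij] unfolding gpath_def R_def by auto
    show "\<not> linked (arcs_ends G) W (R i) (R j)"
    proof
      assume "linked (arcs_ends G) W (R i) (R j)"
      then obtain N s t where *: "set N \<subseteq> W" "i \<le> s" "s < y i" "j \<le> t" "t < y j"
        "chain (arcs_ends G) (P ! s # N @ [P ! t])"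
        unfolding linked_def R_def seg_conv_nth by blast
      show False by (rule no_cross[OF ij *(2-5) *(1,6)])
    qed
  qed
  have R_ne: "R i \<inter> R j = {}" "\<not> linked (arcs_ends G) W (R i) (R j)"
    if ij: "i \<in> I" "j \<in> I" "i \<noteq> j" for i j
    using R_lt[of i j] R_lt[of j i] linked_sym[OF arcs_ends_sym, of W "R i" "R j"] ij
    by (cases "i < j"; force)+
  have R_gain: "\<alpha> W < \<alpha> (W \<union> R i)" if "i \<in> I" for i
    using y(1)[OF that] aW unfolding a_def R_def by simp
  have many: "\<alpha> W + card I \<le> \<alpha> (W \<union> (\<Union>i \<in> I. R i))"
    by (rule alpha_Union_regions[OF finI R_W R_ne R_gain])
  have v_R: "v \<notin> R i" for i using seg_subset[of P] v(2) by (auto simp: R_def)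
  have "\<not> linked (arcs_ends G) W (\<Union>i \<in> I. R i) {v}"
  proof
    assume "linked (arcs_ends G) W (\<Union>i \<in> I. R i) {v}"
    then obtain N i t where *: "set N \<subseteq> W" "i \<in> I" "i \<le> t" "t < y i"
      "chain (arcs_ends G) (P ! t # N @ [v])"
      unfolding linked_def R_def seg_conv_nth by blast
    obtain M where "set M \<subseteq> set N" "distinct M" "chain (arcs_ends G) (P ! t # M @ [v])"
      using *(5) by (rule chain_shortcut)
    then show False using no_detour[OF *(2-4), of M] *(1) W_off by blast
  qed
  then have "\<alpha> (W \<union> (\<Union>i \<in> I. R i) \<union> {v}) + \<alpha> W = \<alpha> (W \<union> (\<Union>i \<in> I. R i)) + \<alpha> (W \<union> {v})"
    using R_W v_R by (intro alpha_modular) (auto simp: W_def)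
  moreover have "m \<le> \<alpha> (W \<union> {v})"
  proof -
    have "S - set P = W \<union> {v}" using v by (auto simp: W_def)
    then show ?thesis using m[OF P] by simp
  qed
  moreover have "\<alpha> (W \<union> (\<Union>i \<in> I. R i) \<union> {v}) \<le> \<alpha> S"
    by (rule alpha_mono) (use v in \<open>auto simp: W_def R_def\<close>)
  ultimately show "m + card I \<le> \<alpha> S" using many by linarith
  have fin_R: "finite (R i)" for i unfolding R_def seg_def by simp
  have "R i \<noteq> {}" if "i \<in> I" for i using R_gain[OF that] by auto
  then have "card I \<le> (\<Sum>i \<in> I. card (R i))"
    using fin_R sum_mono[of I "\<lambda>_. 1::nat" "\<lambda>i. card (R i)"] by (auto simp: Suc_le_eq card_gt_0_iff)
  also have "\<dots> = card (\<Union>i \<in> I. R i)"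
    using R_ne(1) finI fin_R by (intro card_UN_disjoint[symmetric]) auto
  also have "\<dots> \<le> card (S \<inter> set P)"
    by (rule card_mono) (use seg_subset[of P] in \<open>auto simp: R_def\<close>)
  finally show "card I \<le> card (S \<inter> set P)" .
qed

end

section \<open>Paths that lower the independence number\<close>

lemma vwalk_arcs_chain: "set (vwalk_arcs p) \<subseteq> E \<longleftrightarrow> chain E p"
  by (induction p rule: vwalk_arcs.induct) auto

context graph
begin

lemma vpath_iff_gpath: "vpath p G \<longleftrightarrow> gpath p \<and> p \<noteq> []"
  unfolding vpath_def vwalk_def gpath_def vwalk_arcs_chain by blast

lemma no_self_arc: "\<not> u \<rightarrow> u"
  using adj_not_same by blast

lemma finite_paths_between: "finite (paths_between G x y)"
proof (rule finite_subset)
  show "paths_between G x y \<subseteq> {p. set p \<subseteq> verts G \<and> length p \<le> card (verts G)}"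
    using card_mono[OF finite_verts]
    by (auto simp: paths_between_def vpath_iff_gpath gpath_def simp flip: distinct_card)
  show "finite {p. set p \<subseteq> verts G \<and> length p \<le> card (verts G)}"
    by (rule finite_lists_length_le) simp
qed

lemma local_connectivity_attained:
  obtains \<P> where "\<P> \<subseteq> paths_between G x y" "pairwise (\<lambda>p q. set p \<inter> set q = {x, y}) \<P>"
    "card \<P> = local_connectivity G x y"
proof -
  let ?C = "{card P |P. P \<subseteq> paths_between G x y \<and> pairwise (\<lambda>p q. set p \<inter> set q = {x, y}) P}"
  have "?C \<subseteq> card ` Pow (paths_between G x y)" by blast
  then have "finite ?C" by (rule finite_subset) (simp add: finite_paths_between)
  moreover have "card ({} :: 'a list set) \<in> ?C" by (intro CollectI exI[of _ "{}"]) simp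
  ultimately have "Max ?C \<in> ?C" by (intro Max_in) blast+
  then obtain \<P> where "\<P> \<subseteq> paths_between G x y" "pairwise (\<lambda>p q. set p \<inter> set q = {x, y}) \<P>"
    "card \<P> = local_connectivity G x y"
    unfolding local_connectivity_def by auto
  then show ?thesis by (rule that)
qed

text \<open>
  The easy direction of Menger's theorem: internally disjoint paths meet \<open>X\<close> in distinct vertices.
\<close>

lemma local_connectivity_le_separator:
  assumes X: "finite X" "x \<notin> X" "y \<notin> X"
    and hit: "\<And>p. p \<in> paths_between G x y \<Longrightarrow> set p \<inter> X \<noteq> {}"
  shows "local_connectivity G x y \<le> card X"
proof -
  obtain \<P> where P: "\<P> \<subseteq> paths_between G x y" "pairwise (\<lambda>p q. set p \<inter> set q = {x, y}) \<P>"
    "card \<P> = local_connectivity G x y"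
    by (rule local_connectivity_attained)
  have "\<forall>p \<in> \<P>. \<exists>w. w \<in> set p \<inter> X" using hit P(1) by blast
  then obtain h where h: "\<And>p. p \<in> \<P> \<Longrightarrow> h p \<in> set p \<inter> X" by metis
  have "inj_on h \<P>"
  proof (rule inj_onI, rule ccontr)
    fix p q assume pq: "p \<in> \<P>" "q \<in> \<P>" "h p = h q" "p \<noteq> q"
    then have "set p \<inter> set q = {x, y}" using P(2) unfolding pairwise_def by blast
    then show False using h[OF pq(1)] h[OF pq(2)] pq(3) X by auto
  qed
  then have "card \<P> \<le> card X" using h X(1) by (intro card_inj_on_le[of h]) auto
  then show ?thesis using P(3) by simp
qed

text \<open>
  Each path of the linkage starts at a neighbour of \<open>v\<close> and is cut off where it first reaches \<open>P\<close>.
  Reversed, it becomes the list of inner vertices of a fan path.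
\<close>

lemma fan_of_linkage:
  assumes P: "gpath P" and v: "v \<in> verts G" "v \<notin> set P"
    and Q: "linkage {(a, b). a \<rightarrow> b \<and> a \<noteq> v \<and> b \<noteq> v} {a. v \<rightarrow> a} (set P) \<Q>"
  shows "\<exists>I L. fan v P I L \<and> card I = Suc (card \<Q>)"
proof -
  let ?E = "{(a, b). a \<rightarrow> b \<and> a \<noteq> v \<and> b \<noteq> v}"
  have Qp: "q \<noteq> []" "chain ?E q" "v \<rightarrow> hd q" "last q \<in> set P" "distinct q" if "q \<in> \<Q>" for q
    using Q that unfolding linkage_def joins_def by auto
  have off: "set q \<subseteq> verts G - {v}" if "q \<in> \<Q>" for q
  proof -
    have "chain ?E q \<Longrightarrow> hd q \<in> verts G - {v} \<Longrightarrow> set q \<subseteq> verts G - {v}"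
      by (induction q rule: induct_list012) (auto intro: adj_in_verts)
    moreover have "hd q \<in> verts G - {v}" using Qp(3)[OF that] no_self_arc adj_in_verts by auto
    ultimately show ?thesis using Qp(2)[OF that] by blast
  qed
  have "\<forall>q \<in> \<Q>. \<exists>ys t zs. q = ys @ P ! t # zs \<and> t < length P \<and> set ys \<inter> set P = {}"
  proof
    fix q assume q: "q \<in> \<Q>"
    have "set q \<inter> set P \<noteq> {}" using Qp(1,4)[OF q] last_in_set by blast
    then obtain ys z zs where "q = ys @ z # zs" "z \<in> set P" "set ys \<inter> set P = {}" by (rule split_first)
    then show "\<exists>ys t zs. q = ys @ P ! t # zs \<and> t < length P \<and> set ys \<inter> set P = {}"
      by (metis in_set_conv_nth)
  qed
  then obtain ys t zs where s: "\<And>q. q \<in> \<Q> \<Longrightarrow> q = ys q @ P ! t q # zs q"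
    "\<And>q. q \<in> \<Q> \<Longrightarrow> t q < length P" "\<And>q. q \<in> \<Q> \<Longrightarrow> set (ys q) \<inter> set P = {}"
    by metis
  have sub: "set (ys q) \<subseteq> set q" "P ! t q \<in> set q" if "q \<in> \<Q>" for q
    using arg_cong[OF s(1)[OF that], of set] by auto
  have disj: "set p \<inter> set q = {}" if "p \<in> \<Q>" "q \<in> \<Q>" "p \<noteq> q" for p q
    using Q that unfolding linkage_def pairwise_def by blast
  have inj: "inj_on (\<lambda>q. Suc (t q)) \<Q>"
    using disj sub(2) by (intro inj_onI) (metis disjoint_iff nat.inject)
  define I where "I = insert 0 ((\<lambda>q. Suc (t q)) ` \<Q>)"
  define L where "L i = (if i = 0 then [] else rev (ys (inv_into \<Q> (\<lambda>q. Suc (t q)) i)))" for i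
  have L: "L (Suc (t q)) = rev (ys q)" if "q \<in> \<Q>" for q
    using inv_into_f_f[OF inj that] unfolding L_def by simp
  have finQ: "finite \<Q>" using Q unfolding linkage_def by blast
  have ch: "chain (arcs_ends G) (take (Suc (t q)) P @ rev (ys q) @ [v])" if q: "q \<in> \<Q>" for q
  proof -
    have "chain (arcs_ends G) q" using chain_mono[OF Qp(2)[OF q], of "arcs_ends G"] by auto
    then have "chain (arcs_ends G) (v # q)" using Qp(1,3)[OF q] by (simp add: successively_Cons)
    then have "chain (arcs_ends G) ((v # ys q) @ P ! t q # zs q)" using s(1)[OF q] by simp
    from chain_prefix[OF this] have "chain (arcs_ends G) (rev (v # ys q @ [P ! t q]))"
      by (simp only: chain_rev_arcs append.simps)
    then have 1: "chain (arcs_ends G) (P ! t q # rev (ys q) @ [v])" by simp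
    have "chain (arcs_ends G) (take (Suc (t q)) P)"
      by (rule chain_take) (use P in \<open>simp add: gpath_def\<close>)
    then have "chain (arcs_ends G) (take (t q) P @ [P ! t q])"
      using s(2)[OF q] by (simp add: take_Suc_conv_app_nth)
    from chain_glue[OF this 1] show ?thesis
      using s(2)[OF q] by (simp add: take_Suc_conv_app_nth)
  qed
  have dy: "distinct (ys q)" if "q \<in> \<Q>" for q
    using Qp(5)[OF that] s(1)[OF that] by (metis distinct_append)
  have set_L: "set (ys q) \<subseteq> verts G - insert v (set P)" if "q \<in> \<Q>" for q
    using off[OF that] sub(1)[OF that] s(3)[OF that] by blast
  have disj_L: "set (ys p) \<inter> set (ys q) = {}" if "p \<in> \<Q>" "q \<in> \<Q>" "t p \<noteq> t q" for p q
    using disj[OF that(1,2)] that(3) sub(1)[OF that(1)] sub(1)[OF that(2)] by blast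
  have "fan v P I L"
    unfolding fan_def
  proof (intro conjI ballI impI)
    show "0 \<in> I" by (simp add: I_def)
    show "I \<subseteq> {..length P}" using s(2) by (auto simp: I_def Suc_le_eq)
    show L0: "L 0 = []" by (simp add: L_def)
    fix i assume i: "i \<in> I"
    have "i = 0 \<or> (\<exists>q \<in> \<Q>. i = Suc (t q))" using i by (auto simp: I_def)
    then have "distinct (L i) \<and> set (L i) \<subseteq> verts G - insert v (set P) \<and>
        chain (arcs_ends G) (take i P @ L i @ [v])"
      by (elim disjE bexE) (simp_all only: L0 L, simp_all add: dy set_L ch del: append_assoc take_Suc)
    then show "distinct (L i)" "set (L i) \<subseteq> verts G - insert v (set P)"
      "chain (arcs_ends G) (take i P @ L i @ [v])"
      by blast+
    fix j assume j: "j \<in> I" "i \<noteq> j"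
    show "set (L i) \<inter> set (L j) = {}"
    proof (cases "i = 0 \<or> j = 0")
      case False
      then obtain p q where "p \<in> \<Q>" "q \<in> \<Q>" "i = Suc (t p)" "j = Suc (t q)"
        using i j(1) by (auto simp: I_def)
      then show ?thesis using disj_L[of p q] L j(2) by simp
    qed (use L0 in auto)
  qed
  moreover have "card I = Suc (card \<Q>)"
    using card_image[OF inj] finQ card_insert_disjoint[of "(\<lambda>q. Suc (t q)) ` \<Q>" 0] by (simp add: I_def image_iff)
  ultimately show ?thesis by blast
qed

text \<open>
  Menger's theorem is applied in \<open>G - v\<close>, between the neighbourhood of \<open>v\<close> and \<open>P\<close>. A separator that
  is smaller than the number of vertices of \<open>S\<close> on \<open>P\<close> misses some such vertex \<open>s\<close>; it must then meet
  each of the internally disjoint paths from \<open>v\<close> to \<open>s\<close>, and so has at least \<open>\<kappa>\<close> vertices.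
\<close>

lemma fan_exists:
  assumes P: "gpath P" and v: "v \<in> verts G" "v \<notin> set P"
    and conn: "\<And>s. s \<in> S \<inter> set P \<Longrightarrow> \<kappa> \<le> local_connectivity G v s"
  shows "\<exists>I L. fan v P I L \<and> card I = Suc (min \<kappa> (card (S \<inter> set P)))"
proof -
  let ?E = "{(a, b). a \<rightarrow> b \<and> a \<noteq> v \<and> b \<noteq> v}" and ?A = "{a. v \<rightarrow> a}"
  let ?c = "min \<kappa> (card (S \<inter> set P))"
  have "\<exists>\<Q>. linkage ?E ?A (set P) \<Q> \<and> card \<Q> = ?c"
  proof (rule menger)
    show "finite ?E" by (rule finite_subset[of _ "verts G \<times> verts G"]) (auto intro: adj_in_verts)
    show "finite ?A" by (rule finite_subset[of _ "verts G"]) (auto intro: adj_in_verts)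
    fix X assume X: "finite X" "separates ?E ?A (set P) X"
    show "?c \<le> card X"
    proof (rule ccontr)
      assume "\<not> ?c \<le> card X"
      then have less: "card X < \<kappa>" "card X < card (S \<inter> set P)" by auto
      then have "\<not> S \<inter> set P \<subseteq> X" using card_mono[OF X(1)] by (metis not_le)
      then obtain s where s: "s \<in> S" "s \<in> set P" "s \<notin> X" by blast
      have "local_connectivity G v s \<le> card (X - {v})"
      proof (rule local_connectivity_le_separator)
        fix p assume "p \<in> paths_between G v s"
        then have p: "gpath p" "p \<noteq> []" "hd p = v" "last p = s"
          by (auto simp: paths_between_def vpath_iff_gpath)
        then obtain q where pq: "p = v # q" by (cases p) auto
        have q: "q \<noteq> []" using p pq s(2) v(2) by auto
        have vq: "v \<notin> set q" using p(1) pq by (simp add: gpath_def)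
        have "chain (arcs_ends G) q" "v \<rightarrow> hd q"
          using p(1) pq q by (auto simp: gpath_def successively_Cons)
        moreover from this(1) have "chain ?E q"
          by (rule successively_mono) (use vq in auto)
        ultimately have "joins ?E ?A (set P) q" using q p(4) pq s(2) by (simp add: joins_def)
        then show "set p \<inter> (X - {v}) \<noteq> {}"
          using X(2) vq pq unfolding separates_def by auto
      qed (use X s in auto)
      also have "card (X - {v}) \<le> card X" by (rule card_Diff1_le)
      finally show False using conn[of s] s less by simp
    qed
  qed
  then obtain \<Q> where "linkage ?E ?A (set P) \<Q>" "card \<Q> = ?c" by (elim exE conjE)
  then show ?thesis using fan_of_linkage[OF P v, of \<Q>] by simp
qed

lemma alpha_singleton: "x \<in> verts G \<Longrightarrow> \<alpha> {x} = 1"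
  using alpha_upper[of "{x}" "{x}"] alpha_insert_le[of x "{}"] no_self_arc
  by (simp add: independent_in_def alpha_empty)

text \<open>
  The passage to a smallest \<open>U\<close> in \<open>S\<close> with \<open>\<alpha>(U - V(P)) \<ge> m\<close> for all paths \<open>P\<close> serves to find a
  vertex \<open>v\<close> whose capture alone would bring \<open>\<alpha>\<close> below \<open>m\<close>. The fan may at first have fewer than \<open>\<kappa>\<close>
  paths when \<open>P\<close> carries few vertices of \<open>U\<close>, but there are more stretches than fan paths, each with
  a vertex of \<open>U\<close>, so this does not happen.
\<close>

theorem path_reducing_alpha:
  assumes S: "S \<subseteq> verts G"
    and conn: "\<And>x y. x \<in> S \<Longrightarrow> y \<in> S \<Longrightarrow> x \<noteq> y \<Longrightarrow> \<kappa> \<le> local_connectivity G x y"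
  shows "\<exists>P. gpath P \<and> (S \<subseteq> set P \<or> \<alpha> (S - set P) + \<kappa> + 1 \<le> \<alpha> S)"
proof -
  have nil: "gpath []" by (simp add: gpath_def)
  obtain P0 where P0: "gpath P0" "\<And>R. gpath R \<Longrightarrow> \<alpha> (S - set P0) \<le> \<alpha> (S - set R)"
    using ex_has_least_nat[of gpath "[]" "\<lambda>P. \<alpha> (S - set P)"] nil by blast
  define m where "m = \<alpha> (S - set P0)"
  show ?thesis
  proof (cases "m = 0")
    case True
    have "S \<subseteq> set P0"
    proof (rule ccontr)
      assume "\<not> S \<subseteq> set P0"
      then obtain x where x: "x \<in> S - set P0" by blast
      then have "\<alpha> {x} \<le> m" unfolding m_def by (intro alpha_mono) simp
      then show False using True x S alpha_singleton[of x] by auto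
    qed
    then show ?thesis using P0(1) by blast
  next
    case False
    define good where "good U \<longleftrightarrow> U \<subseteq> S \<and> (\<forall>R. gpath R \<longrightarrow> m \<le> \<alpha> (U - set R))" for U
    have "good S" using P0(2) by (simp add: good_def m_def)
    then obtain U where U: "good U" "\<And>U'. good U' \<Longrightarrow> card U \<le> card U'"
      using ex_has_least_nat[of good S card] by blast
    have US: "U \<subseteq> S" and mU: "\<And>R. gpath R \<Longrightarrow> m \<le> \<alpha> (U - set R)"
      using U(1) unfolding good_def by blast+
    have "U \<noteq> {}" using mU[OF nil] False by (auto simp: alpha_empty)
    then obtain v where v: "v \<in> U" by blast
    have "finite U" by (rule finite_subset[OF subset_trans[OF US S]]) simp
    then have "card (U - {v}) < card U" using v by (rule card_Diff1_less)
    then have "\<not> good (U - {v})" using U(2) by fastforce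
    moreover have "U - {v} \<subseteq> S" using US by blast
    ultimately obtain P where P: "gpath P" "\<alpha> (U - {v} - set P) < m"
      unfolding good_def not_le[symmetric] by blast
    have vP: "v \<notin> set P"
    proof
      assume "v \<in> set P"
      then have "U - {v} - set P = U - set P" by blast
      then show False using P mU[OF P(1)] by simp
    qed
    have vG: "v \<in> verts G" using v US S by blast
    define c where "c = min \<kappa> (card (U \<inter> set P))"
    have "\<exists>I L. fan v P I L \<and> card I = Suc c"
      unfolding c_def by (rule fan_exists[OF P(1) vG vP]) (use conn v vP US in blast)
    moreover have "\<forall>I. (\<exists>L. fan v P I L \<and> card I = Suc c) \<longrightarrow> \<Sum>I < Suc (\<Sum>{..length P})"
      unfolding fan_def by (auto simp: less_Suc_eq_le intro: sum_mono2)
    ultimately obtain I where I: "\<exists>L. fan v P I L \<and> card I = Suc c"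
      "\<And>I'. \<exists>L. fan v P I' L \<and> card I' = Suc c \<Longrightarrow> \<Sum>I' \<le> \<Sum>I"
      using ex_has_greatest_nat[of "\<lambda>I. \<exists>L. fan v P I L \<and> card I = Suc c" _ "\<lambda>I. \<Sum>I" "Suc (\<Sum>{..length P})"]
      by blast
    obtain L where L: "fan v P I L" "card I = Suc c" using I(1) by blast
    have crit: "\<alpha> (U - set P - {v}) < m" 
    proof -
      have "U - set P - {v} = U - {v} - set P" by blast
      then show ?thesis using P(2) by simp
    qed
    note bound = extremal_fan_bound[OF P(1) v vP subset_trans[OF US S] mU crit L(1)]
    have ext: "\<Sum>I' \<le> \<Sum>I" if "fan v P I' L'" "card I' = card I" for I' L'
      using I(2) that L(2) by auto
    have "m + card I \<le> \<alpha> U" "card I \<le> card (U \<inter> set P)"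
      using bound ext by blast+
    then have "m + \<kappa> + 1 \<le> \<alpha> U" using L(2) unfolding c_def by (auto simp: min_def split: if_splits)
    then show ?thesis using P0(1) alpha_mono[OF US] unfolding m_def by (meson le_trans)
  qed
qed

end

section \<open>Attaching paths to trees\<close>

lemma head_last_cas:
  "pre_digraph.cas T u p w \<Longrightarrow> p \<noteq> [] \<Longrightarrow> head T (last p) = w"
  by (induction p arbitrary: u) (auto simp: pre_digraph.cas.simps)

lemma cas_split:
  "pre_digraph.cas T u (xs @ e # ys) w \<longleftrightarrow>
     pre_digraph.cas T u xs (tail T e) \<and> pre_digraph.cas T (head T e) ys w"
  by (induction xs arbitrary: u) (auto simp: pre_digraph.cas.simps)

lemma cas_append: 
  "pre_digraph.cas T u xs x \<Longrightarrow> pre_digraph.cas T x ys w \<Longrightarrow> pre_digraph.cas T u (xs @ ys) w"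
  by (induction xs arbitrary: u) (auto simp: pre_digraph.cas.simps)

text \<open>
  Cycles in terms of the heads of their arcs, which, unlike the list of vertices, are merely permuted
  when the cycle is rotated.
\<close>

lemma cycle_iff_cas:
  "pre_digraph.cycle T p \<longleftrightarrow> p \<noteq> [] \<and> set p \<subseteq> arcs T \<and> distinct (map (head T) p) \<and>
     (\<exists>u \<in> verts T. pre_digraph.cas T u p u)"
  unfolding pre_digraph.cycle_def pre_digraph.awalk_def
  by (auto simp: pre_digraph.awalk_verts_conv')

context graph
begin

definition add_pendant :: "('a, 'b) pre_digraph \<Rightarrow> 'a \<Rightarrow> 'a \<Rightarrow> ('a, 'b) pre_digraph" where
  "add_pendant T a b = \<lparr>verts = insert b (verts T),
     arcs = arcs T \<union> {e \<in> arcs G. arc_to_ends G e \<in> {(a, b), (b, a)}}, tail = tail G, head = head G\<rparr>"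

lemma verts_add_pendant [simp]: "verts (add_pendant T a b) = insert b (verts T)"
  by (simp add: add_pendant_def)

context
  fixes T a b
  assumes T: "subgraph T G" "is_tree T" and ab: "a \<in> verts T" "b \<notin> verts T" "a \<rightarrow> b"
begin

lemma pendant_arc_ex:
  obtains e f where "e \<in> arcs G" "tail G e = a" "head G e = b"
    "f \<in> arcs G" "tail G f = b" "head G f = a"
    "arcs (add_pendant T a b) = insert e (insert f (arcs T))" "e \<notin> arcs T" "f \<notin> arcs T"
proof -
  obtain e where e: "e \<in> arcs G" "arc_to_ends G e = (a, b)" using ab(3) unfolding arcs_ends_def by auto
  obtain f where f: "f \<in> arcs G" "arc_to_ends G f = (b, a)"
    using graph_symmetric[OF ab(3)] unfolding arcs_ends_def by auto
  have "{x \<in> arcs G. arc_to_ends G x \<in> {(a, b), (b, a)}} = {e, f}"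
    using e f no_multi_arcs by fastforce
  moreover have "tail T = tail G" "head T = head G" "wf_digraph T"
    using T(1) unfolding subgraph_def compatible_def by auto
  then have "x \<in> arcs T \<Longrightarrow> tail G x \<noteq> b \<and> head G x \<noteq> b" for x
    using ab(2) wf_digraph.tail_in_verts wf_digraph.head_in_verts by metis
  ultimately show ?thesis using e f by (intro that[of e f]) (auto simp: add_pendant_def arc_to_ends_def)
qed

lemma subgraph_add_pendant: "subgraph (add_pendant T a b) G"
proof (rule subgraphI)
  have "b \<in> verts G" using ab(3) by (rule adj_in_verts)
  then show "verts (add_pendant T a b) \<subseteq> verts G" using T(1) by (auto simp: subgraph_def)
  show "arcs (add_pendant T a b) \<subseteq> arcs G" using T(1) by (auto simp: add_pendant_def subgraph_def)
  show "compatible G (add_pendant T a b)" by (simp add: add_pendant_def compatible_def)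
  have ct: "tail T = tail G" "head T = head G" "wf_digraph T"
    using T(1) unfolding subgraph_def compatible_def by auto
  show "wf_digraph (add_pendant T a b)"
  proof
    fix e assume "e \<in> arcs (add_pendant T a b)"
    then have "tail G e \<in> insert b (verts T) \<and> head G e \<in> insert b (verts T)"
      using ab(1) wf_digraph.tail_in_verts[OF ct(3)] wf_digraph.head_in_verts[OF ct(3)]
      unfolding add_pendant_def ct by (auto simp: arc_to_ends_def)
    then show "tail (add_pendant T a b) e \<in> verts (add_pendant T a b)"
      "head (add_pendant T a b) e \<in> verts (add_pendant T a b)"
      by (simp_all add: add_pendant_def)
  qed
qed (rule wf_digraph_axioms)

lemma tail_head_add_pendant:
  "tail (add_pendant T a b) = tail G" "head (add_pendant T a b) = head G"
  "tail T = tail G" "head T = head G"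
  using T(1) by (auto simp: add_pendant_def subgraph_def compatible_def)

lemma arcs_ends_add_pendant: "arcs_ends (add_pendant T a b) = arcs_ends T \<union> {(a, b), (b, a)}"
proof -
  obtain e f where "tail G e = a" "head G e = b" "tail G f = b" "head G f = a"
    "arcs (add_pendant T a b) = insert e (insert f (arcs T))"
    by (rule pendant_arc_ex)
  then show ?thesis unfolding arcs_ends_conv tail_head_add_pendant by auto
qed

lemma graph_add_pendant: "graph (add_pendant T a b)"
proof -
  have "graph T" using T(2) unfolding is_tree_def by blast
  then have "sym (arcs_ends T)" using graph.arcs_ends_sym by blast
  then have "symmetric (add_pendant T a b)"
    unfolding symmetric_def arcs_ends_add_pendant by (auto simp: sym_def)
  then show ?thesis by (rule digraph.graphI[OF digraph_subgraph[OF subgraph_add_pendant]])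
qed

lemma connected_add_pendant: "connected (add_pendant T a b)"
proof -
  let ?T = "add_pendant T a b"
  interpret T': graph ?T by (rule graph_add_pendant)
  interpret T: graph T using T(2) unfolding is_tree_def by blast
  have sub: "subgraph T ?T"
  proof (rule subgraphI)
    show "verts T \<subseteq> verts ?T" by auto
    show "arcs T \<subseteq> arcs ?T" by (auto simp: add_pendant_def)
    show "compatible ?T T" by (simp add: compatible_def tail_head_add_pendant)
  qed (rule T.wf_digraph_axioms T'.wf_digraph_axioms)+
  have "x \<rightarrow>\<^sup>*\<^bsub>T\<^esub> y" if "x \<in> verts T" "y \<in> verts T" for x y
    using T(2) that unfolding is_tree_def connected_def strongly_connected_def
    by (simp add: T.reachable_mk_symmetric_eq[OF T.sym_arcs])
  then have TT: "x \<rightarrow>\<^sup>*\<^bsub>?T\<^esub> y" if "x \<in> verts T" "y \<in> verts T" for x y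
    using T'.reachable_mono[OF _ sub] that by blast
  have "a \<rightarrow>\<^bsub>?T\<^esub> b" "b \<rightarrow>\<^bsub>?T\<^esub> a" by (simp_all add: arcs_ends_add_pendant)
  then have "a \<rightarrow>\<^sup>*\<^bsub>?T\<^esub> b" "b \<rightarrow>\<^sup>*\<^bsub>?T\<^esub> a" by blast+
  then have "x \<rightarrow>\<^sup>*\<^bsub>?T\<^esub> a \<and> a \<rightarrow>\<^sup>*\<^bsub>?T\<^esub> x" if "x \<in> verts ?T" for x
    using that TT ab(1) by auto
  then have "x \<rightarrow>\<^sup>*\<^bsub>?T\<^esub> y" if "x \<in> verts ?T" "y \<in> verts ?T" for x y
    using that T'.reachable_trans by blast
  then show ?thesis
    unfolding connected_def strongly_connected_def
    by (simp add: T'.reachable_mk_symmetric_eq[OF T'.sym_arcs])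
qed

text \<open>
  A cycle through \<open>b\<close> enters it by the arc \<open>e\<close> from \<open>a\<close> and leaves it by the arc \<open>f\<close> to \<open>a\<close>. Then the
  cycle visits \<open>a\<close> twice unless it has length two.
\<close>

lemma acyclic_add_pendant:
  assumes "pre_digraph.cycle (add_pendant T a b) p"
  shows "length p < 3"
proof (rule ccontr)
  assume long: "\<not> length p < 3"
  let ?T = "add_pendant T a b"
  obtain e f where ef: "tail G e = a" "head G e = b" "tail G f = b" "head G f = a"
    "arcs ?T = insert e (insert f (arcs T))"
    by (rule pendant_arc_ex)
  have wf: "wf_digraph T" using T(1) by (simp add: subgraph_def)
  have inT: "tail G x \<in> verts T" "head G x \<in> verts T" if "x \<in> arcs T" for x
    using that wf_digraph.wellformed[OF wf] by (simp_all add: tail_head_add_pendant)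
  have nb: "a \<noteq> b" using ab by blast
  obtain u where p: "p \<noteq> []" "set p \<subseteq> arcs ?T" "distinct (map (head G) p)" "pre_digraph.cas ?T u p u"
    using assms unfolding cycle_iff_cas tail_head_add_pendant by blast
  have only_f: "x = f" if "x \<in> arcs ?T" "tail G x = b" for x
    using that ef inT ab(2) nb by auto
  have only_e: "x = e" if "x \<in> arcs ?T" "head G x = b" for x
    using that ef inT ab(2) nb by auto
  have no_e: "e \<notin> set p"
  proof
    assume "e \<in> set p"
    then obtain xs ys where xy: "p = xs @ e # ys" by (meson split_list)
    \<comment> \<open>Rotate the cycle so that it starts in \<open>b\<close>, right after the arc \<open>e\<close>.\<close>
    have "pre_digraph.cas ?T b (ys @ xs) a"
      using p(4) cas_append[of ?T b ys u xs a] unfolding xy cas_split tail_head_add_pendant ef by blast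
    moreover obtain g zs where g: "ys @ xs = g # zs" "zs \<noteq> []"
    proof -
      have "2 \<le> length (ys @ xs)" using long unfolding xy by simp
      then show ?thesis by (cases "ys @ xs") (auto intro: that)
    qed
    ultimately have c: "tail G g = b" "pre_digraph.cas ?T (head G g) zs a"
      by (simp_all add: pre_digraph.cas.simps tail_head_add_pendant)
    have "set (g # zs) \<subseteq> arcs ?T" using p(2) unfolding g(1)[symmetric] xy by auto
    then have "g = f" using only_f c(1) by simp
    moreover have "head G (last zs) = a"
      using head_last_cas[OF c(2) g(2)] by (simp add: tail_head_add_pendant)
    moreover have "distinct (map (head G) (g # zs))"
      using p(3) unfolding g(1)[symmetric] xy by auto
    ultimately show False using ef(4) g(2) by (auto simp: in_set_conv_nth dest: last_in_set)
  qed
  have no_f: "f \<notin> set p"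
  proof
    assume "f \<in> set p"
    then obtain xs ys where xy: "p = xs @ f # ys" by (meson split_list)
    have "pre_digraph.cas ?T a (ys @ xs) b"
      using p(4) cas_append[of ?T a ys u xs b] unfolding xy cas_split tail_head_add_pendant ef by blast
    moreover have ne: "ys @ xs \<noteq> []" using long unfolding xy by auto
    ultimately have "head G (last (ys @ xs)) = b"
      using head_last_cas by (metis tail_head_add_pendant(2))
    moreover have "last (ys @ xs) \<in> set p" using last_in_set[OF ne] unfolding xy by auto
    ultimately show False using only_e p(2) no_e by blast
  qed
  have "set p \<subseteq> arcs T" using p(2) no_e no_f unfolding ef(5) by blast
  moreover have "pre_digraph.cas T u p u"
    using p(4) compatible_cas[of T ?T] by (simp add: compatible_def tail_head_add_pendant)
  moreover have "u \<in> verts T"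
    using calculation inT p(1) by (cases p) (auto simp: pre_digraph.cas.simps tail_head_add_pendant)
  ultimately have "pre_digraph.cycle T p"
    using p(1,3) unfolding cycle_iff_cas tail_head_add_pendant by blast
  then show False using T(2) long unfolding is_tree_def by (meson not_le)
qed

lemma is_tree_add_pendant: "is_tree (add_pendant T a b)"
  unfolding is_tree_def using graph_add_pendant connected_add_pendant acyclic_add_pendant
  by (meson not_le)

lemma out_degree_add_pendant:
  "out_degree (add_pendant T a b) b = 1"
  "out_degree (add_pendant T a b) a = Suc (out_degree T a)"
  "w \<noteq> a \<Longrightarrow> w \<noteq> b \<Longrightarrow> out_degree (add_pendant T a b) w = out_degree T w"
proof -
  obtain e f where ef: "tail G e = a" "head G e = b" "tail G f = b" "head G f = a"
    "arcs (add_pendant T a b) = insert e (insert f (arcs T))" "e \<notin> arcs T" "f \<notin> arcs T"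
    by (rule pendant_arc_ex)
  have wf: "wf_digraph T" using T(1) by (simp add: subgraph_def)
  have inT: "tail G x \<noteq> b" if "x \<in> arcs T" for x
    using that wf_digraph.wellformed(1)[OF wf that] ab(2) by (auto simp: tail_head_add_pendant)
  have nb: "a \<noteq> b" using ab by blast
  have "finite (arcs T)" using T(1) finite_subset[OF _ finite_arcs] by (simp add: subgraph_def)
  then have fin: "finite (out_arcs T a)" unfolding out_arcs_def by simp
  have "out_arcs (add_pendant T a b) b = {f}"
    using inT ef nb unfolding out_arcs_def tail_head_add_pendant by auto
  then show "out_degree (add_pendant T a b) b = 1" by (simp add: out_degree_def)
  have "out_arcs (add_pendant T a b) a = insert e (out_arcs T a)"
    using ef nb unfolding out_arcs_def tail_head_add_pendant by auto
  moreover have "e \<notin> out_arcs T a" using ef(6) by (simp add: out_arcs_def)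
  ultimately show "out_degree (add_pendant T a b) a = Suc (out_degree T a)"
    using fin by (simp add: out_degree_def)
  assume w: "w \<noteq> a" "w \<noteq> b"
  have "out_arcs (add_pendant T a b) w = out_arcs T w"
    using ef w unfolding out_arcs_def tail_head_add_pendant by auto
  then show "out_degree (add_pendant T a b) w = out_degree T w" by (simp add: out_degree_def)
qed

lemma leaves_add_pendant:
  "b \<in> leaves (add_pendant T a b)"
  "leaves (add_pendant T a b) \<subseteq> insert b (insert a (leaves T))"
  "out_degree T a \<noteq> 0 \<Longrightarrow> leaves (add_pendant T a b) \<subseteq> insert b (leaves T - {a})"
proof -
  show "b \<in> leaves (add_pendant T a b)" using out_degree_add_pendant(1) by (simp add: leaves_def)
  show sub: "leaves (add_pendant T a b) \<subseteq> insert b (insert a (leaves T))"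
    using out_degree_add_pendant(3) by (auto simp: leaves_def)
  assume "out_degree T a \<noteq> 0"
  then have "a \<notin> leaves (add_pendant T a b)" using out_degree_add_pendant(2) by (simp add: leaves_def)
  then show "leaves (add_pendant T a b) \<subseteq> insert b (leaves T - {a})" using sub by blast
qed

end

text \<open>
  Growing the path from its end keeps the number of leaves, as the previous end ceases to be a leaf.
  Only the first step creates a new one. The start \<open>a\<close> itself can become a leaf only when it was
  isolated, that is, when the tree was a single vertex.
\<close>

lemma tree_attach_path:
  assumes T: "subgraph T G" "is_tree T" and a: "a \<in> verts T"
    and Q: "Q \<noteq> []" "distinct Q" "set Q \<inter> verts T = {}" "chain (arcs_ends G) (a # Q)"
  shows "\<exists>T'. subgraph T' G \<and> is_tree T' \<and> verts T' = verts T \<union> set Q \<and> last Q \<in> leaves T' \<and>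
    leaves T' \<subseteq> insert (last Q) (insert a (leaves T)) \<and>
    (out_degree T a \<noteq> 0 \<longrightarrow> leaves T' \<subseteq> insert (last Q) (leaves T))"
  using Q
proof (induction Q rule: rev_nonempty_induct)
  case (single b)
  then have b: "b \<notin> verts T" "a \<rightarrow> b" by auto
  show ?case
    using subgraph_add_pendant[OF T a b] is_tree_add_pendant[OF T a b] leaves_add_pendant[OF T a b]
    by (intro exI[of _ "add_pendant T a b"]) auto
next
  case (snoc b Q)
  have "chain (arcs_ends G) ((a # Q) @ [b])" using snoc.prems(3) by simp
  then have c: "chain (arcs_ends G) (a # Q)" "last Q \<rightarrow> b"
    using snoc.hyps by (auto simp only: successively_append_iff) auto
  obtain T' where T': "subgraph T' G" "is_tree T'" "verts T' = verts T \<union> set Q" "last Q \<in> leaves T'"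
    "leaves T' \<subseteq> insert (last Q) (insert a (leaves T))"
    "out_degree T a \<noteq> 0 \<longrightarrow> leaves T' \<subseteq> insert (last Q) (leaves T)"
    using snoc.IH snoc.prems c(1) by auto
  have b: "b \<notin> verts T'" "last Q \<in> verts T'" using snoc T'(3) by auto
  note l = leaves_add_pendant[OF T'(1,2) b(2,1) c(2)]
  have "out_degree T' (last Q) \<noteq> 0" using T'(4) by (simp add: leaves_def)
  then have "leaves (add_pendant T' (last Q) b) \<subseteq> insert b (leaves T' - {last Q})" by (rule l(3))
  then show ?case
    using subgraph_add_pendant[OF T'(1,2) b(2,1) c(2)] is_tree_add_pendant[OF T'(1,2) b(2,1) c(2)] l(1) T'
    by (intro exI[of _ "add_pendant T' (last Q) b"]) auto
qed

lemma tree_isolated_vertex: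
  assumes T: "is_tree T" and a: "a \<in> verts T" "out_degree T a = 0"
  shows "verts T = {a}"
proof -
  interpret T: graph T using T unfolding is_tree_def by blast
  have noarc: "\<not> a \<rightarrow>\<^bsub>T\<^esub> y" for y
    using a(2) T.finite_out_arcs unfolding out_degree_def out_arcs_def arcs_ends_conv by auto
  have "x = a" if "x \<in> verts T" for x
  proof -
    have "a \<rightarrow>\<^sup>*\<^bsub>T\<^esub> x"
      using T that a(1) unfolding is_tree_def connected_def strongly_connected_def
      by (simp add: T.reachable_mk_symmetric_eq[OF T.sym_arcs])
    then show ?thesis
      by (induction rule: T.reachable_induct) (use noarc in auto)
  qed
  then show ?thesis using a(1) by blast
qed

text \<open>
  A tree with a single vertex has no leaf and acquires two; this is within the bound for \<open>k \<ge> 1\<close>.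
\<close>

lemma k_ended_tree_attach_path:
  assumes T: "k_ended_tree_in k T G" "1 \<le> k" and a: "a \<in> verts T"
    and Q: "Q \<noteq> []" "distinct Q" "set Q \<inter> verts T = {}" "chain (arcs_ends G) (a # Q)"
  shows "\<exists>T'. k_ended_tree_in (Suc k) T' G \<and> verts T' = verts T \<union> set Q"
proof -
  have T': "subgraph T G" "is_tree T" "card (leaves T) \<le> k"
    using T(1) unfolding k_ended_tree_in_def by auto
  obtain T2 where T2: "subgraph T2 G" "is_tree T2" "verts T2 = verts T \<union> set Q"
    "leaves T2 \<subseteq> insert (last Q) (insert a (leaves T))"
    "out_degree T a \<noteq> 0 \<longrightarrow> leaves T2 \<subseteq> insert (last Q) (leaves T)"
    using tree_attach_path[OF T'(1,2) a Q] by blast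
  have "finite (verts T)" using T'(1) finite_subset[OF _ finite_verts] by (simp add: subgraph_def)
  then have fin: "finite (leaves T)" by (simp add: leaves_def)
  have "card (leaves T2) \<le> Suc k"
  proof (cases "out_degree T a = 0")
    case True
    then have "leaves T = {}" using tree_isolated_vertex[OF T'(2) a] by (auto simp: leaves_def)
    then have "leaves T2 \<subseteq> {last Q, a}" using T2(4) by simp
    then have "card (leaves T2) \<le> card {last Q, a}" by (intro card_mono) simp_all
    also have "\<dots> \<le> 2" by (simp add: card_insert_if)
    finally show ?thesis using T(2) by simp
  next
    case False
    then have "card (leaves T2) \<le> card (insert (last Q) (leaves T))"
      using T2(5) fin by (intro card_mono) auto
    then show ?thesis using T'(3) fin by (simp add: card_insert_if split: if_splits)
  qed
  then show ?thesis using T2 unfolding k_ended_tree_in_def by blast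
qed

lemma single_vertex_tree:
  assumes "x \<in> verts G"
  shows "\<exists>T. k_ended_tree_in k T G \<and> verts T = {x}"
proof -
  define T where "T = \<lparr>verts = {x}, arcs = ({} :: 'b set), tail = tail G, head = head G\<rparr>"
  have sub: "subgraph T G"
    by (rule subgraphI) (use assms in \<open>auto simp: T_def compatible_def wf_digraph_axioms wf_digraph_def\<close>)
  then have "digraph T" by (rule digraph_subgraph)
  then have gT: "graph T"
    by (rule digraph.graphI) (simp add: symmetric_def arcs_ends_def T_def sym_def)
  interpret T: graph T by (rule gT)
  have vT: "verts T = {x}" by (simp add: T_def)
  then have "x \<rightarrow>\<^sup>*\<^bsub>T\<^esub> x" by (intro T.reachable_refl) simp
  then have "connected T"
    unfolding connected_def strongly_connected_def
    by (simp add: T.reachable_mk_symmetric_eq[OF T.sym_arcs] vT)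
  moreover have "\<not> pre_digraph.cycle T p" for p
    unfolding cycle_iff_cas by (auto simp: T_def)
  ultimately have "is_tree T" using gT unfolding is_tree_def by blast
  moreover have "leaves T = {}" by (simp add: leaves_def out_degree_def out_arcs_def T_def)
  ultimately show ?thesis using sub vT unfolding k_ended_tree_in_def
    by (intro exI[of _ T]) simp
qed

lemma path_tree:
  assumes "gpath P" "P \<noteq> []"
  shows "\<exists>T. k_ended_tree_in 2 T G \<and> verts T = set P"
proof -
  obtain x Q where P: "P = x # Q" using assms(2) by (cases P) auto
  have x: "x \<in> verts G" using assms(1) P by (simp add: gpath_def)
  show ?thesis
  proof (cases "Q = []")
    case True
    then show ?thesis using single_vertex_tree[OF x, of 2] P by auto
  next
    case False
    obtain T where T: "k_ended_tree_in 1 T G" "verts T = {x}"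
      using single_vertex_tree[OF x, of 1] by blast
    have "\<exists>T'. k_ended_tree_in (Suc 1) T' G \<and> verts T' = verts T \<union> set Q"
      by (rule k_ended_tree_attach_path[OF T(1) _ _ False]) (use assms(1) P T(2) in \<open>auto simp: gpath_def\<close>)
    then show ?thesis using T(2) P by (simp add: numeral_2_eq_2)
  qed
qed

end

section \<open>Trees with few leaves\<close>

context graph
begin

lemma connected_reachable: "connected G \<Longrightarrow> x \<in> verts G \<Longrightarrow> y \<in> verts G \<Longrightarrow> x \<rightarrow>\<^sup>* y"
  unfolding connected_def strongly_connected_def
  by (simp add: reachable_mk_symmetric_eq[OF sym_arcs])

text \<open>
  A longest path that leaves \<open>U\<close> and ends in \<open>S\<close> cannot be extended, so its last vertex has no
  neighbour in the part of \<open>S\<close> that remains uncovered.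
\<close>

lemma path_reducing_alpha_outside:
  assumes conn: "connected G" and U: "U \<noteq> {}" "U \<subseteq> verts G" and S: "S \<subseteq> verts G" "\<not> S \<subseteq> U"
  shows "\<exists>a Q. a \<in> U \<and> Q \<noteq> [] \<and> distinct Q \<and> set Q \<inter> U = {} \<and> chain (arcs_ends G) (a # Q) \<and>
    \<alpha> (S - (U \<union> set Q)) < \<alpha> (S - U)"
proof -
  define good where "good Q \<longleftrightarrow> Q \<noteq> [] \<and> distinct Q \<and> set Q \<inter> U = {} \<and> last Q \<in> S \<and>
    (\<exists>a \<in> U. chain (arcs_ends G) (a # Q))" for Q
  have ex: "\<exists>Q. good Q"
  proof -
    obtain u s where us: "u \<in> U" "s \<in> S" "s \<notin> U" using U S by blast
    then have "u \<rightarrow>\<^sup>* s" using conn U S by (intro connected_reachable) auto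
    then obtain p where "vwalk p G" "hd p = u" "last p = s" unfolding reachable_vwalk_conv by blast
    then obtain p where "vpath p G" "hd p = u" "last p = s" using vwalk_imp_ex_vpath by metis
    then have p: "distinct p" "chain (arcs_ends G) p" "p \<noteq> []" "hd p = u" "last p = s"
      unfolding vpath_iff_gpath gpath_def by blast+
    have "set p \<inter> U \<noteq> {}" using p us(1) hd_in_set by blast
    then obtain ys a zs where s: "p = ys @ a # zs" "a \<in> U" "set zs \<inter> U = {}" by (rule split_last)
    have "zs \<noteq> []" using s p us by auto
    moreover have "chain (arcs_ends G) (a # zs)" using p(2) unfolding s(1) by (rule chain_suffix)
    ultimately have "good zs" using s p us unfolding good_def by auto
    then show ?thesis by blast
  qed
  have bound: "length Q < Suc (card (verts G))" if "good Q" for Q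
  proof -
    obtain a where a: "chain (arcs_ends G) (a # Q)" using \<open>good Q\<close> unfolding good_def by blast
    have "chain (arcs_ends G) (a # Q) \<Longrightarrow> set Q \<subseteq> verts G"
      by (induction Q arbitrary: a) (auto intro: adj_in_verts)
    then have "card (set Q) \<le> card (verts G)" using a by (intro card_mono) simp_all
    then show ?thesis using \<open>good Q\<close> unfolding good_def by (simp add: distinct_card)
  qed
  obtain Q where Q: "good Q" "\<And>R. good R \<Longrightarrow> length R \<le> length Q"
    using ex_has_greatest_nat[of good _ length "Suc (card (verts G))"] ex bound by blast
  obtain a where a: "a \<in> U" "chain (arcs_ends G) (a # Q)" using Q(1) unfolding good_def by blast
  have q: "Q \<noteq> []" "last Q \<in> S" "last Q \<notin> U" using Q(1) last_in_set unfolding good_def by blast+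
  have stuck: "\<not> last Q \<rightarrow> w" if w: "w \<in> S - (U \<union> set Q)" for w
  proof
    assume "last Q \<rightarrow> w"
    then have "chain (arcs_ends G) ((a # Q) @ [w])"
      using a(2) q(1) by (simp only: successively_append_iff) simp
    then have "good (Q @ [w])" using Q(1) w a(1) unfolding good_def by auto
    then show False using Q(2)[of "Q @ [w]"] by simp
  qed
  have "\<alpha> ({last Q} \<union> (S - (U \<union> set Q))) = \<alpha> {last Q} + \<alpha> (S - (U \<union> set Q))"
    by (rule alpha_Un) (use stuck q(1) in auto)
  moreover have "\<alpha> ({last Q} \<union> (S - (U \<union> set Q))) \<le> \<alpha> (S - U)"
    by (rule alpha_mono) (use q in auto)
  moreover have "\<alpha> {last Q} = 1" using q(2) S(1) by (intro alpha_singleton) blast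
  ultimately have "\<alpha> (S - (U \<union> set Q)) < \<alpha> (S - U)" by simp
  then show ?thesis using a Q(1) unfolding good_def by blast
qed

text \<open>
  The inequality is arranged so that all numbers stay natural; a tree that covers \<open>S\<close> has to be kept
  as a separate case because its uncovered part cannot shrink any further.
\<close>

lemma k_ended_tree_reducing_alpha:
  assumes conn: "connected G" and k: "2 \<le> k" and S: "S \<subseteq> verts G"
    and kappa: "\<And>x y. x \<in> S \<Longrightarrow> y \<in> S \<Longrightarrow> x \<noteq> y \<Longrightarrow> \<kappa> \<le> local_connectivity G x y"
  shows "\<exists>T. k_ended_tree_in k T G \<and> verts T \<noteq> {} \<and>
    (S \<subseteq> verts T \<or> \<alpha> (S - verts T) + \<kappa> + k \<le> \<alpha> S + 1)"
  using k
proof (induction k rule: dec_induct)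
  case base
  obtain P where P: "gpath P" "S \<subseteq> set P \<or> \<alpha> (S - set P) + \<kappa> + 1 \<le> \<alpha> S"
    using path_reducing_alpha[OF S kappa] by blast
  show ?case
  proof (cases "P = []")
    case False
    then show ?thesis using path_tree[OF P(1)] P(2) by fastforce
  next
    case True
    have "verts G \<noteq> {}" using conn unfolding connected_def strongly_connected_def by simp
    then obtain x where x: "x \<in> verts G" by blast
    then obtain T where T: "k_ended_tree_in 2 T G" "verts T = {x}" using single_vertex_tree by blast
    have "\<alpha> (S - {x}) \<le> \<alpha> S" by (rule alpha_mono) blast
    then show ?thesis using T P(2) True by (intro exI[of _ T]) auto
  qed
next
  case (step k)
  then obtain T where T: "k_ended_tree_in k T G" "verts T \<noteq> {}"
    "S \<subseteq> verts T \<or> \<alpha> (S - verts T) + \<kappa> + k \<le> \<alpha> S + 1"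
    by blast
  show ?case
  proof (cases "S \<subseteq> verts T")
    case True
    then show ?thesis using T(1,2) unfolding k_ended_tree_in_def by (meson le_SucI)
  next
    case False
    have "verts T \<subseteq> verts G" using T(1) unfolding k_ended_tree_in_def subgraph_def by blast
    then obtain a Q where aQ: "a \<in> verts T" "Q \<noteq> []" "distinct Q" "set Q \<inter> verts T = {}"
      "chain (arcs_ends G) (a # Q)" "\<alpha> (S - (verts T \<union> set Q)) < \<alpha> (S - verts T)"
      using path_reducing_alpha_outside[OF conn T(2) _ S False] by blast
    obtain T' where "k_ended_tree_in (Suc k) T' G" "verts T' = verts T \<union> set Q"
      using k_ended_tree_attach_path[OF T(1) _ aQ(1-5)] step.hyps by auto
    then show ?thesis using T(2,3) False aQ(6) by (intro exI[of _ T']) auto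
  qed
qed

end

lemma set_connectivity_finite:
  fixes G :: "('a, 'b) pre_digraph"
  assumes "finite S" "x \<in> S" "y \<in> S" "x \<noteq> y"
  obtains \<kappa> where "set_connectivity G S = enat \<kappa>"
    "\<And>x y. x \<in> S \<Longrightarrow> y \<in> S \<Longrightarrow> x \<noteq> y \<Longrightarrow> \<kappa> \<le> local_connectivity G x y"
proof -
  let ?C = "{local_connectivity G x y | x y. x \<in> S \<and> y \<in> S \<and> x \<noteq> y}"
  have "\<not> card S \<le> 1" using assms card_le_Suc0_iff_eq[of S] by auto
  then have "set_connectivity G S = enat (Min ?C)" by (simp add: set_connectivity_def)
  moreover have "?C \<subseteq> (\<lambda>(x, y). local_connectivity G x y) ` (S \<times> S)" by auto
  then have "finite ?C" by (rule finite_subset) (simp add: assms(1))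
  then have "Min ?C \<le> local_connectivity G x y" if "x \<in> S" "y \<in> S" "x \<noteq> y" for x y
    using that by (intro Min_le) auto
  ultimately show ?thesis by (rule that)
qed

theorem theorem1p7:
  fixes G :: "('a, 'b) pre_digraph" and S :: "'a set" and k :: nat
  assumes "graph G" and "connected G" and "k \<ge> 2" and "S \<subseteq> verts G"
  shows "(\<exists>T. k_ended_tree_in k T G \<and> S \<subseteq> verts T) \<or>
    (\<exists>T. k_ended_tree_in k T G \<and>
       ereal (real (alpha G (S - verts T))) \<le>
         ereal (real (alpha G S)) - ereal_of_enat (set_connectivity G S) - ereal (real k) + 1)"
proof -
  interpret graph G by (rule assms(1))
  show ?thesis
  proof (cases "\<exists>x \<in> S. \<exists>y \<in> S. x \<noteq> y")
    case True
    have "finite S" by (rule finite_subset[OF assms(4)]) simp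
    then obtain \<kappa> where \<kappa>: "set_connectivity G S = enat \<kappa>"
      "\<And>x y. x \<in> S \<Longrightarrow> y \<in> S \<Longrightarrow> x \<noteq> y \<Longrightarrow> \<kappa> \<le> local_connectivity G x y"
      using True set_connectivity_finite[of S] by metis
    obtain T where T: "k_ended_tree_in k T G"
      "S \<subseteq> verts T \<or> alpha G (S - verts T) + \<kappa> + k \<le> alpha G S + 1"
      using k_ended_tree_reducing_alpha[OF assms(2-4) \<kappa>(2)] by blast
    have "ereal (real (alpha G (S - verts T))) \<le>
         ereal (real (alpha G S)) - ereal_of_enat (set_connectivity G S) - ereal (real k) + 1"
      if "alpha G (S - verts T) + \<kappa> + k \<le> alpha G S + 1"
      using that by (simp add: \<kappa>(1) one_ereal_def)
    then show ?thesis using T by blast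
  next
    case False
    have "verts G \<noteq> {}" using assms(2) unfolding connected_def strongly_connected_def by simp
    then obtain x where "x \<in> verts G" "S \<subseteq> {x}" using False assms(4) by blast
    then show ?thesis using single_vertex_tree[of x k] by auto
  qed
qed

end
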